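(* Let $T$ be a semi-infinite banded stochastic matrix ($p$ subdiagonals, $q$ superdiagonals) admitting a positive bidiagonal factorization (equivalently, a stochastic bidiagonal factorization), let $A^{(a)}_n,B^{(b)}_n$ be its recursion polynomials and $(\mathrm d\psi_{b,a})$ the associated matrix of positive spectral measures on $[0,1]$, and denote by $m_{b,a}$ the mass of $\mathrm d\psi_{b,a}$ at the point $x=1$. The Markov chain on $\mathbb N_0$ with transition matrix $T$ is ergodic (positive recurrent) if and only if $1$ is a mass point of the spectral measures with masses $m_{1,1}>0$ and $m_{b,a}\ge0$ for $a\in\{1,\dots,p\}$, $b\in\{1,\dots,q\}$. In that case, the corresponding stationary distribution is $\pi=(\pi_0,\pi_1,\pi_2,\dots)$ with $$\pi_n=\sum_{a=1}^p\sum_{b=1}^q B_n^{(b)}(1)\,m_{b,a}\,A_n^{(a)}(1),\qquad n\in\mathbb N_0.$$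
   Context: The chain is called ergodic (positive recurrent) if all states are recurrent with finite expected return time. A stationary distribution is a sequence $\pi_n\ge0$ with $\sum_n\pi_n=1$ and $\pi T=\pi$. Semi-infinite matrices are indexed by $\mathbb N_0$. $p,q\ge1$ are integers. $T$ is stochastic (nonnegative entries, rows sum to $1$) and banded: $T_{n,m}=0$ unless $n-p\le m\le n+q$, with positive entries inside the band. A positive bidiagonal factorization is $T=\mathscr L_1\cdots\mathscr L_p\mathscr U_q\cdots\mathscr U_1$ with each $\mathscr L_i$ lower bidiagonal with positive main diagonal and first subdiagonal, and each $\mathscr U_j$ upper bidiagonal with positive main diagonal and first superdiagonal (all other entries zero); it is a stochastic bidiagonal factorization if moreover all factors are stochastic. $T^{[N]}=(T_{n,m})_{n,m=0}^N$; its eigenvalues $\lambda_0^{[N]}>\dots>\lambda_N^{[N]}$ are simple and lie in $(0,1)$ (known). Recursion polynomials. Let $\nu\in\mathbb R^{p\times p}$ and $\xi\in\mathbb R^{q\times q}$ be real unitriangular lower matrices (ones on the diagonal, zeros above; the initial conditions). For $a\in\{1,\dots,p\}$, the polynomials $A^{(a)}_n(x)$, $n\ge0$, are determined by $A^{(a)}_n=\nu_{n+1,a}$ for $0\le n\le p-1$ and $\sum_{l\ge0}A^{(a)}_l T_{l,n}=xA^{(a)}_n$, $n\ge0$. For $b\in\{1,\dots,q\}$, $B^{(b)}_n(x)$ are determined by $B^{(b)}_n=\xi_{n+1,b}$ for $0\le n\le q-1$ and $\sum_{l\ge0}T_{n,l}B^{(b)}_l=xB^{(b)}_n$, $n\ge0$.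 Let $P_0=1$, $P_{M}(x)=\det(xI_{M}-T^{[M-1]})$ for $M\ge1$; $\alpha_0=\beta_0=1$, $\alpha_N=(-1)^{(p-1)N}T_{p,0}\cdots T_{N+p-1,N-1}$, $\beta_N=(-1)^{(q-1)N}T_{0,q}\cdots T_{N-1,N+q-1}$ for $N\ge1$. For $n\ge0$, $Q_{n,N}$ is the $p\times p$ determinant with rows $(A^{(1)}_l,\dots,A^{(p)}_l)$, $l=n,N+1,\dots,N+p-1$ (in this order), and $R_{n,N}$ is the $q\times q$ determinant with rows $(B^{(1)}_l,\dots,B^{(q)}_l)$, $l=n,N+1,\dots,N+q-1$. Put $u^{\langle N\rangle}_{k,n}=\beta_N R_{n,N}(\lambda_k^{[N]})$, $w^{\langle N\rangle}_{k,n}=\dfrac{\alpha_N Q_{n,N}(\lambda_k^{[N]})}{P_N(\lambda_k^{[N]})P_{N+1}'(\lambda_k^{[N]})}$ ($n\ge0$, $0\le k\le N$): for $0\le n\le N$ these are the entries of right, resp. left, eigenvectors of $T^{[N]}$ for $\lambda_k^{[N]}$, biorthonormal: $\sum_{n=0}^N w^{\langle N\rangle}_{k,n}u^{\langle N\rangle}_{l,n}=\delta_{k,l}$ (known). The Christoffel numbers are $(\mu_{k,1}^{[N]},\dots,\mu_{k,p}^{[N]})^\top=\nu^{-1}(w_{k,0}^{\langle N\rangle},\dots,w_{k,p-1}^{\langle N\rangle})^\top$, $(\rho_{k,1}^{[N]},\dots,\rho_{k,q}^{[N]})^\top=\xi^{-1}(u_{k,0}^{\langle N\rangle},\dots,u_{k,q-1}^{\langle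 N\rangle})^\top$. The discrete measures are $\mathrm d\psi^{[N]}_{b,a}=\sum_{k=0}^N\rho^{[N]}_{k,b}\mu^{[N]}_{k,a}\,\delta_{\lambda_k^{[N]}}$. Standing choice of initial conditions: $\nu,\xi$ are chosen so that all Christoffel numbers $\rho^{[N]}_{k,b}$, $\mu^{[N]}_{k,a}$ ($0\le k\le N$) are positive for all sufficiently large $N$; when $T$ has a positive bidiagonal factorization such a choice exists (known). The total masses of $\mathrm d\psi^{[N]}_{b,a}$ are then uniformly bounded in $N$, and $\mathrm d\psi_{b,a}$ denotes the weak limit, as $N\to\infty$ (along a subsequence), of $\mathrm d\psi^{[N]}_{b,a}$: a finite positive Borel measure on $[0,1]$. Known spectral (Favard-type) theorem: $(T^k)_{n,m}=\sum_{a=1}^p\sum_{b=1}^q\int_0^1B_n^{(b)}(x)x^k\,\mathrm d\psi_{b,a}(x)A_m^{(a)}(x)$ for all $k,n,m\in\mathbb N_0$. *)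

theory Defs
  imports
    "HOL-Probability.Probability"
    "Jordan_Normal_Form.Char_Poly"
    "Jordan_Normal_Form.Gauss_Jordan_Elimination"
begin

text \<open>
  Semi-infinite matrices are functions \<open>nat \<Rightarrow> nat \<Rightarrow> real\<close>, rows first. The superscripts
  \<open>a \<in> {1,\<dots>,p}\<close> and \<open>b \<in> {1,\<dots>,q}\<close> of the recursion polynomials, Christoffel numbers and
  measures are shifted to \<open>a < p\<close> and \<open>b < q\<close>, so that \<open>A\<^sup>(\<^sup>1\<^sup>)\<close> is \<open>A 0\<close>
  and \<open>\<psi>\<^sub>1\<^sub>,\<^sub>1\<close> is \<open>\<psi> 0 0\<close>.
\<close>

type_synonym inf_mat = "nat \<Rightarrow> nat \<Rightarrow> real"

definition stochastic :: "inf_mat \<Rightarrow> bool" where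
  "stochastic T \<longleftrightarrow> (\<forall>n m. 0 \<le> T n m) \<and> (\<forall>n. T n sums 1)"

definition positive_banded :: "nat \<Rightarrow> nat \<Rightarrow> inf_mat \<Rightarrow> bool" where
  "positive_banded p q T \<longleftrightarrow>
     (\<forall>n m. if n \<le> m + p \<and> m \<le> n + q then 0 < T n m else T n m = 0)"

text \<open>All products formed below have row-finite left factors, so the series are finite sums.\<close>

definition inf_mat_mult :: "inf_mat \<Rightarrow> inf_mat \<Rightarrow> inf_mat" where
  "inf_mat_mult A B = (\<lambda>n m. \<Sum>l. A n l * B l m)"

definition inf_mat_id :: inf_mat where
  "inf_mat_id = (\<lambda>n m. if n = m then 1 else 0)"

definition pos_lower_bidiagonal :: "inf_mat \<Rightarrow> bool" where
  "pos_lower_bidiagonal L \<longleftrightarrow>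
     (\<forall>n m. if n = m \<or> n = Suc m then 0 < L n m else L n m = 0)"

definition pos_upper_bidiagonal :: "inf_mat \<Rightarrow> bool" where
  "pos_upper_bidiagonal U \<longleftrightarrow>
     (\<forall>n m. if m = n \<or> m = Suc n then 0 < U n m else U n m = 0)"

text \<open>\<open>Ls\<close> lists \<open>L\<^sub>1, \<dots>, L\<^sub>p\<close> and \<open>Us\<close> lists \<open>U\<^sub>q, \<dots>, U\<^sub>1\<close>.\<close>

definition has_pbf :: "nat \<Rightarrow> nat \<Rightarrow> inf_mat \<Rightarrow> bool" where
  "has_pbf p q T \<longleftrightarrow>
     (\<exists>Ls Us. length Ls = p \<and> length Us = q \<and>
        (\<forall>L\<in>set Ls. pos_lower_bidiagonal L) \<and> (\<forall>U\<in>set Us. pos_upper_bidiagonal U) \<and>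
        T = foldr inf_mat_mult (Ls @ Us) inf_mat_id)"


text \<open>
  A Markov chain \<open>X\<close> with transition matrix \<open>T\<close>; \<open>M i\<close> is the law under which the chain starts
  at \<open>i\<close>. The Markov property is stated in product form, which avoids conditioning on null events.
\<close>

definition markov_chain :: "inf_mat \<Rightarrow> (nat \<Rightarrow> 's measure) \<Rightarrow> (nat \<Rightarrow> 's \<Rightarrow> nat) \<Rightarrow> bool" where
  "markov_chain T M X \<longleftrightarrow>
     (\<forall>i. prob_space (M i) \<and>
        (\<forall>t. X t \<in> measurable (M i) (count_space UNIV)) \<and>
        (AE \<omega> in M i. X 0 \<omega> = i) \<and>
        (\<forall>t s. measure (M i) {\<omega> \<in> space (M i). \<forall>r\<le>Suc t. X r \<omega> = s r} =
               measure (M i) {\<omega> \<in> space (M i). \<forall>r\<le>t. X r \<omega> = s r} * T (s t) (s (Suc t))))"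

text \<open>The infimum of the empty set is \<open>\<infinity>\<close>, the value on paths which never return.\<close>

definition return_time :: "(nat \<Rightarrow> 's \<Rightarrow> nat) \<Rightarrow> nat \<Rightarrow> 's \<Rightarrow> ennreal" where
  "return_time X i \<omega> = (INF t\<in>{t. 1 \<le> t \<and> X t \<omega> = i}. of_nat t)"

definition ergodic :: "(nat \<Rightarrow> 's measure) \<Rightarrow> (nat \<Rightarrow> 's \<Rightarrow> nat) \<Rightarrow> bool" where
  "ergodic M X \<longleftrightarrow>
     (\<forall>i. (AE \<omega> in M i. return_time X i \<omega> < \<infinity>) \<and>
          (\<integral>\<^sup>+ \<omega>. return_time X i \<omega> \<partial>M i) < \<infinity>)"

definition stationary_distribution :: "inf_mat \<Rightarrow> (nat \<Rightarrow> real) \<Rightarrow> bool" where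
  "stationary_distribution T \<pi> \<longleftrightarrow>
     (\<forall>n. 0 \<le> \<pi> n) \<and> \<pi> sums 1 \<and> (\<forall>m. (\<lambda>n. \<pi> n * T n m) sums \<pi> m)"


definition lower_unitriangular :: "nat \<Rightarrow> real mat \<Rightarrow> bool" where
  "lower_unitriangular d \<nu> \<longleftrightarrow> \<nu> \<in> carrier_mat d d \<and>
     (\<forall>i<d. \<nu> $$ (i, i) = 1) \<and> (\<forall>i<d. \<forall>j<d. i < j \<longrightarrow> \<nu> $$ (i, j) = 0)"

text \<open>
  For a banded \<open>T\<close>, the entries beyond \<open>n + p\<close> in column \<open>n\<close>, and beyond \<open>n + q\<close> in row \<open>n\<close>,
  vanish, which is why the sums may be cut off there.
\<close>

definition left_recursion_polys ::
  "nat \<Rightarrow> inf_mat \<Rightarrow> real mat \<Rightarrow> (nat \<Rightarrow> nat \<Rightarrow> real poly) \<Rightarrow> bool" where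
  "left_recursion_polys p T \<nu> A \<longleftrightarrow>
     (\<forall>a<p. (\<forall>n<p. A a n = [:\<nu> $$ (n, a):]) \<and>
        (\<forall>n. (\<Sum>l\<le>n + p. Polynomial.smult (T l n) (A a l)) = [:0, 1:] * A a n))"

definition right_recursion_polys ::
  "nat \<Rightarrow> inf_mat \<Rightarrow> real mat \<Rightarrow> (nat \<Rightarrow> nat \<Rightarrow> real poly) \<Rightarrow> bool" where
  "right_recursion_polys q T \<xi> B \<longleftrightarrow>
     (\<forall>b<q. (\<forall>n<q. B b n = [:\<xi> $$ (n, b):]) \<and>
        (\<forall>n. (\<Sum>l\<le>n + q. Polynomial.smult (T n l) (B b l)) = [:0, 1:] * B b n))"

text \<open>
  The leading \<open>M \<times> M\<close> section; the truncation \<open>T\<^sup>[\<^sup>N\<^sup>]\<close> is \<open>leading_section T (Suc N)\<close>.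
\<close>

definition leading_section :: "inf_mat \<Rightarrow> nat \<Rightarrow> real mat" where
  "leading_section T M = Matrix.mat M M (\<lambda>(i, j). T i j)"

definition charP :: "inf_mat \<Rightarrow> nat \<Rightarrow> real poly" where
  "charP T M = char_poly (leading_section T M)"

definition alpha :: "nat \<Rightarrow> inf_mat \<Rightarrow> nat \<Rightarrow> real" where
  "alpha p T N = (- 1) ^ ((p - 1) * N) * (\<Prod>i<N. T (p + i) i)"

definition beta :: "nat \<Rightarrow> inf_mat \<Rightarrow> nat \<Rightarrow> real" where
  "beta q T N = (- 1) ^ ((q - 1) * N) * (\<Prod>i<N. T i (q + i))"

text \<open>
  The determinant, evaluated at \<open>x\<close>, with rows \<open>(F\<^sub>0(l), \<dots>, F\<^sub>d\<^sub>-\<^sub>1(l))\<close> for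
  \<open>l = n, N+1, \<dots>, N+d-1\<close>: it is \<open>Q\<^sub>n\<^sub>,\<^sub>N(x)\<close> for \<open>d = p\<close>, \<open>F = A\<close>, and
  \<open>R\<^sub>n\<^sub>,\<^sub>N(x)\<close> for \<open>d = q\<close>, \<open>F = B\<close>.
\<close>

definition rec_det ::
  "nat \<Rightarrow> (nat \<Rightarrow> nat \<Rightarrow> real poly) \<Rightarrow> nat \<Rightarrow> nat \<Rightarrow> real \<Rightarrow> real" where
  "rec_det d F n N x =
     Determinant.det (Matrix.mat d d (\<lambda>(i, j). poly (F j (if i = 0 then n else N + i)) x))"

text \<open>
  \<open>lam N k\<close> for \<open>k \<le> N\<close> names the \<open>k\<close>-th largest eigenvalue of the truncation \<open>T\<^sup>[\<^sup>N\<^sup>]\<close>.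
\<close>

definition decreasing_eigenvalues :: "inf_mat \<Rightarrow> (nat \<Rightarrow> nat \<Rightarrow> real) \<Rightarrow> bool" where
  "decreasing_eigenvalues T lam \<longleftrightarrow>
     (\<forall>N. (\<forall>k<N. lam N (Suc k) < lam N k) \<and>
          {x. eigenvalue (leading_section T (Suc N)) x} = lam N ` {..N})"

definition u_entry ::
  "nat \<Rightarrow> inf_mat \<Rightarrow> (nat \<Rightarrow> nat \<Rightarrow> real poly) \<Rightarrow> (nat \<Rightarrow> nat \<Rightarrow> real) \<Rightarrow>
   nat \<Rightarrow> nat \<Rightarrow> nat \<Rightarrow> real" where
  "u_entry q T B lam N k n = beta q T N * rec_det q B n N (lam N k)"

definition w_entry ::
  "nat \<Rightarrow> inf_mat \<Rightarrow> (nat \<Rightarrow> nat \<Rightarrow> real poly) \<Rightarrow> (nat \<Rightarrow> nat \<Rightarrow> real) \<Rightarrow>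
   nat \<Rightarrow> nat \<Rightarrow> nat \<Rightarrow> real" where
  "w_entry p T A lam N k n =
     alpha p T N * rec_det p A n N (lam N k) /
       (poly (charP T N) (lam N k) * poly (pderiv (charP T (Suc N))) (lam N k))"

definition christoffel_mu ::
  "nat \<Rightarrow> inf_mat \<Rightarrow> real mat \<Rightarrow> (nat \<Rightarrow> nat \<Rightarrow> real poly) \<Rightarrow> (nat \<Rightarrow> nat \<Rightarrow> real) \<Rightarrow>
   nat \<Rightarrow> nat \<Rightarrow> nat \<Rightarrow> real" where
  "christoffel_mu p T \<nu> A lam N k a =
     vec_index (the (mat_inverse \<nu>) *\<^sub>v Matrix.vec p (w_entry p T A lam N k)) a"

definition christoffel_rho ::
  "nat \<Rightarrow> inf_mat \<Rightarrow> real mat \<Rightarrow> (nat \<Rightarrow> nat \<Rightarrow> real poly) \<Rightarrow> (nat \<Rightarrow> nat \<Rightarrow> real) \<Rightarrow>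
   nat \<Rightarrow> nat \<Rightarrow> nat \<Rightarrow> real" where
  "christoffel_rho q T \<xi> B lam N k b =
     vec_index (the (mat_inverse \<xi>) *\<^sub>v Matrix.vec q (u_entry q T B lam N k)) b"

definition christoffel_positive ::
  "nat \<Rightarrow> nat \<Rightarrow> inf_mat \<Rightarrow> real mat \<Rightarrow> real mat \<Rightarrow> (nat \<Rightarrow> nat \<Rightarrow> real poly) \<Rightarrow>
   (nat \<Rightarrow> nat \<Rightarrow> real poly) \<Rightarrow> (nat \<Rightarrow> nat \<Rightarrow> real) \<Rightarrow> bool" where
  "christoffel_positive p q T \<nu> \<xi> A B lam \<longleftrightarrow>
     (\<forall>\<^sub>F N in sequentially. \<forall>k\<le>N.
        (\<forall>b<q. 0 < christoffel_rho q T \<xi> B lam N k b) \<and>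
        (\<forall>a<p. 0 < christoffel_mu p T \<nu> A lam N k a))"

text \<open>
  The discrete measure with mass \<open>\<rho>\<^sub>k\<^sub>,\<^sub>b \<mu>\<^sub>k\<^sub>,\<^sub>a\<close> at the \<open>k\<close>-th eigenvalue, \<open>k \<le> N\<close>.
  The truncation of negative values by \<open>ennreal\<close> is harmless: only large \<open>N\<close> matter, for which
  the Christoffel numbers are positive.
\<close>

definition discrete_measure ::
  "nat \<Rightarrow> nat \<Rightarrow> inf_mat \<Rightarrow> real mat \<Rightarrow> real mat \<Rightarrow> (nat \<Rightarrow> nat \<Rightarrow> real poly) \<Rightarrow>
   (nat \<Rightarrow> nat \<Rightarrow> real poly) \<Rightarrow> (nat \<Rightarrow> nat \<Rightarrow> real) \<Rightarrow> nat \<Rightarrow> nat \<Rightarrow> nat \<Rightarrow> real measure" where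
  "discrete_measure p q T \<nu> \<xi> A B lam N b a =
     distr
       (point_measure {..N}
          (\<lambda>k. ennreal (christoffel_rho q T \<xi> B lam N k b * christoffel_mu p T \<nu> A lam N k a)))
       borel (lam N)"

text \<open>
  Weak convergence is tested on bounded continuous functions; the total masses are not normalized.
\<close>

definition converges_weakly :: "(nat \<Rightarrow> real measure) \<Rightarrow> real measure \<Rightarrow> bool" where
  "converges_weakly \<mu> \<mu>' \<longleftrightarrow>
     (\<forall>f :: real \<Rightarrow> real. continuous_on UNIV f \<and> bounded (range f) \<longrightarrow>
        (\<lambda>j. integral\<^sup>L (\<mu> j) f) \<longlonglongrightarrow> integral\<^sup>L \<mu>' f)"

text \<open>
  \<open>\<psi> b a\<close> is the limit of the discrete measures along one subsequence \<open>r\<close> common to all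
  \<open>b\<close> and \<open>a\<close>; measures on \<open>[0,1]\<close> are Borel measures on \<open>\<real>\<close> that vanish outside \<open>[0,1]\<close>.
\<close>

definition spectral_measures ::
  "nat \<Rightarrow> nat \<Rightarrow> inf_mat \<Rightarrow> real mat \<Rightarrow> real mat \<Rightarrow> (nat \<Rightarrow> nat \<Rightarrow> real poly) \<Rightarrow>
   (nat \<Rightarrow> nat \<Rightarrow> real poly) \<Rightarrow> (nat \<Rightarrow> nat \<Rightarrow> real) \<Rightarrow> (nat \<Rightarrow> nat \<Rightarrow> real measure) \<Rightarrow> bool" where
  "spectral_measures p q T \<nu> \<xi> A B lam \<psi> \<longleftrightarrow>
     (\<forall>b<q. \<forall>a<p. sets (\<psi> b a) = sets borel \<and> finite_measure (\<psi> b a) \<and>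
        emeasure (\<psi> b a) (- {0..1}) = 0) \<and>
     (\<exists>r :: nat \<Rightarrow> nat. strict_mono r \<and>
        (\<forall>b<q. \<forall>a<p.
           converges_weakly (\<lambda>j. discrete_measure p q T \<nu> \<xi> A B lam (r j) b a) (\<psi> b a)))"

end

theory Submission
  imports Defs
begin

text \<open>
  The argument runs through the powers \<open>T\<^sup>k\<close>. A Christoffel--Darboux identity for the truncations of
  \<open>T\<close> shows that the eigenvectors built from the recursion polynomials are biorthonormal; passing to
  the weak limit gives \<open>(T\<^sup>k)\<^sub>n\<^sub>m = \<Sum>\<^sub>b\<^sub>,\<^sub>a \<integral> x\<^sup>k B\<^sub>n A\<^sub>m d\<psi>\<^sub>b\<^sub>,\<^sub>a\<close> on \<open>[0,1]\<close>, so that by dominated convergence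
  \<open>(T\<^sup>k)\<^sub>n\<^sub>m\<close> converges to \<open>L\<^sub>n\<^sub>m = \<Sum>\<^sub>b\<^sub>,\<^sub>a B\<^sub>n(1) m\<^sub>b\<^sub>,\<^sub>a A\<^sub>m(1)\<close>, and \<open>L\<^sub>0\<^sub>0\<close> is the mass of the first
  measure. Decomposing paths at the last visit to \<open>i\<close> shows that \<open>L\<^sub>n\<^sub>i\<close> times the expected
  return time to \<open>i\<close> is \<open>1\<close> when this time is finite, and that it is finite when \<open>L\<^sub>n\<^sub>i > 0\<close>. The
  convergence of the powers replaces the renewal theorem here.
\<close>

subsection \<open>Determinants of recursion polynomials\<close>

text \<open>Transposing \<open>T\<close> exchanges the two recursions, so each determinant identity
  is proved once, for the right recursion, and then transferred to \<open>A\<close>.\<close>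

lemma left_recursion_polys_transpose:
  "left_recursion_polys p T \<nu> A \<longleftrightarrow> right_recursion_polys p (\<lambda>n m. T m n) \<nu> A"
  by (simp add: left_recursion_polys_def right_recursion_polys_def)

lemma alpha_transpose: "alpha p T N = beta p (\<lambda>n m. T m n) N"
  by (simp add: alpha_def beta_def)

lemma leading_section_carrier [simp]: "leading_section T M \<in> carrier_mat M M"
  by (simp add: leading_section_def)

lemma charP_transpose: "charP (\<lambda>n m. T m n) M = charP T M"
proof -
  have "leading_section (\<lambda>n m. T m n) M = transpose_mat (leading_section T M)"
    by (rule eq_matI) (auto simp: leading_section_def)
  then show ?thesis
    by (simp add: charP_def char_poly_transpose_mat[of _ M])
qed

lemma right_recursion_polys_eval:
  assumes "right_recursion_polys d T \<xi> F" "b < d"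
  shows "(\<Sum>l\<le>n + d. T n l * poly (F b l) x) = x * poly (F b n) x"
proof -
  have "poly (\<Sum>l\<le>n + d. Polynomial.smult (T n l) (F b l)) x = poly ([:0, 1:] * F b n) x"
    using assms by (simp add: right_recursion_polys_def)
  then show ?thesis
    by (simp add: poly_sum)
qed

lemma banded_row_sum:
  fixes T :: inf_mat
  assumes "\<And>n m. n + d < m \<Longrightarrow> T n m = 0" "n + d < M"
  shows "(\<Sum>l<M. T n l * g l) = (\<Sum>l\<le>n + d. T n l * g l)"
  using assms by (intro sum.mono_neutral_right) auto

lemma poly_charP:
  "poly (charP T N) x = Determinant.det (Matrix.mat N N (\<lambda>(i, j). (if i = j then x else 0) - T i j))"
proof -
  have "- char_matrix (leading_section T N) x = Matrix.mat N N (\<lambda>(i, j). (if i = j then x else 0) - T i j)"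
    by (rule eq_matI) (auto simp: leading_section_def char_matrix_def)
  then show ?thesis
    by (simp add: charP_def char_poly_matrix[of _ N])
qed

lemma det_lower_unitriangular:
  assumes "lower_unitriangular d \<nu>"
  shows "Determinant.det \<nu> = 1"
proof -
  have "Determinant.det \<nu> = prod_list (diag_mat \<nu>)"
    using assms by (intro det_lower_triangular[of d]) (auto simp: lower_unitriangular_def)
  also have "\<dots> = 1"
    using assms by (auto simp: prod_list_diag_prod lower_unitriangular_def)
  finally show ?thesis .
qed

text \<open>
  The triangular matrix \<open>S\<close> lists the first \<open>d\<close> unit rows and the first \<open>N\<close> rows of \<open>x - T\<close>; the first
  \<open>d\<close> columns of \<open>G\<close> are annihilated by the latter, the remaining ones are unit columns. Comparing
  determinants in \<open>S * G\<close> gives the claim.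
\<close>

lemma beta_rec_det_eq_charP:
  assumes d: "0 < d" and band: "\<And>n m. n + d < m \<Longrightarrow> T n m = 0"
    and \<xi>: "lower_unitriangular d \<xi>" and rec: "right_recursion_polys d T \<xi> F"
  shows "beta d T N * rec_det d F N N x = poly (charP T N) x"
proof -
  define S where "S = Matrix.mat (N + d) (N + d)
    (\<lambda>(i, j). if i < d then (if i = j then 1 else 0) else (if j = i - d then x else 0) - T (i - d) j)"
  define G where "G = Matrix.mat (N + d) (N + d)
    (\<lambda>(i, j). if j < d then poly (F j i) x else if i = j - d then 1 else (0::real))"
  define K where "K = Matrix.mat N N (\<lambda>(i, j). (if i = j then x else 0) - T i j)"
  define R where "R = Matrix.mat d d (\<lambda>(i, j). poly (F j (N + i)) x)"
  define V where "V = Matrix.mat N d (\<lambda>(i, j). poly (F j i) x)"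
  define Y where "Y = Matrix.mat d N (\<lambda>(i, j). if i = j then 1 else (0::real))"
  have SG_car: "S \<in> carrier_mat (N + d) (N + d)" "G \<in> carrier_mat (N + d) (N + d)"
    by (auto simp: S_def G_def)
  have \<xi>c: "\<xi> \<in> carrier_mat d d"
    using \<xi> by (simp add: lower_unitriangular_def)
  have det_\<xi>: "Determinant.det \<xi> = 1"
    using \<xi> by (rule det_lower_unitriangular)
  have det_S: "Determinant.det S = (\<Prod>i<N. - T i (d + i))"
  proof -
    have "Determinant.det S = prod_list (diag_mat S)"
      using d band by (intro det_lower_triangular[OF _ SG_car(1)]) (auto simp: S_def)
    also have "\<dots> = (\<Prod>i = 0..<d + N. S $$ (i, i))"
      using SG_car by (simp add: prod_list_diag_prod add.commute)
    also have "\<dots> = (\<Prod>i = 0..<d. S $$ (i, i)) * (\<Prod>i = d..<d + N. S $$ (i, i))"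
      by (rule prod.atLeastLessThan_concat[symmetric]) auto
    also have "(\<Prod>i = 0..<d. S $$ (i, i)) = 1"
      by (intro prod.neutral) (auto simp: S_def)
    also have "(\<Prod>i = d..<d + N. S $$ (i, i)) = (\<Prod>i<N. - T i (d + i))"
      using d by (intro prod.reindex_bij_witness[of _ "\<lambda>i. d + i" "\<lambda>i. i - d"]) (auto simp: S_def)
    finally show ?thesis by simp
  qed
  have "S * G = four_block_mat \<xi> Y (0\<^sub>m N d) K"
  proof (rule eq_matI)
    fix i j assume "i < dim_row (four_block_mat \<xi> Y (0\<^sub>m N d) K)"
      and "j < dim_col (four_block_mat \<xi> Y (0\<^sub>m N d) K)"
    then have ij: "i < N + d" "j < N + d"
      using \<xi>c by (auto simp: K_def)
    have SG: "(S * G) $$ (i, j) = (\<Sum>l<N + d. S $$ (i, l) * G $$ (l, j))"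
      using ij SG_car by (auto simp: scalar_prod_def lessThan_atLeast0)
    show "(S * G) $$ (i, j) = four_block_mat \<xi> Y (0\<^sub>m N d) K $$ (i, j)"
    proof (cases "i < d")
      case True
      have "(S * G) $$ (i, j) = (\<Sum>l<N + d. if i = l then G $$ (i, j) else 0)"
        unfolding SG using True ij by (intro sum.cong) (auto simp: S_def)
      also have "\<dots> = G $$ (i, j)"
        using ij by simp
      also have "\<dots> = four_block_mat \<xi> Y (0\<^sub>m N d) K $$ (i, j)"
        using rec ij True \<xi>c
        by (auto simp: G_def Y_def K_def right_recursion_polys_def)
      finally show ?thesis .
    next
      case False
      define k where "k = i - d"
      have k: "k < N" "i = k + d"
        using False ij by (auto simp: k_def)
      have "(S * G) $$ (i, j) =
          (\<Sum>l<N + d. (if l = k then x * G $$ (k, j) else 0) - T k l * G $$ (l, j))"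
        unfolding SG using k ij by (intro sum.cong) (auto simp: S_def algebra_simps)
      also have "\<dots> = x * G $$ (k, j) - (\<Sum>l<N + d. T k l * G $$ (l, j))"
        using k by (simp add: sum_subtractf)
      also have "\<dots> = four_block_mat \<xi> Y (0\<^sub>m N d) K $$ (i, j)"
      proof (cases "j < d")
        case True
        have "(\<Sum>l<N + d. T k l * G $$ (l, j)) = (\<Sum>l<N + d. T k l * poly (F j l) x)"
          using True ij by (intro sum.cong) (auto simp: G_def)
        also have "\<dots> = x * poly (F j k) x"
          using right_recursion_polys_eval[OF rec True] band k
          by (subst banded_row_sum[where d = d]) auto
        finally show ?thesis
          using True k ij \<xi>c by (simp add: G_def K_def)
      next
        case False
        have "(\<Sum>l<N + d. T k l * G $$ (l, j)) = (\<Sum>l<N + d. if l = j - d then T k (j - d) else 0)"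
          using False ij by (intro sum.cong) (auto simp: G_def)
        also have "\<dots> = T k (j - d)"
          using False ij by simp
        finally show ?thesis
          using False k ij \<xi>c by (auto simp: G_def K_def)
      qed
      finally show ?thesis .
    qed
  qed (use SG_car \<xi>c in \<open>auto simp: K_def\<close>)
  then have "Determinant.det (S * G) = Determinant.det \<xi> * Determinant.det K"
    using \<xi>c by (simp add: K_def Y_def det_four_block_mat_lower_left_zero[of _ d _ N])
  moreover have "Determinant.det (S * G) = Determinant.det S * Determinant.det G"
    using SG_car by (rule det_mult)
  moreover have "Determinant.det G = (- 1) ^ (d * N) * Determinant.det R"
  proof -
    \<comment> \<open>Exchanging the first \<open>N\<close> rows of \<open>G\<close> with its last
      \<open>d\<close> rows gives a block lower triangular matrix with diagonal blocks
      \<open>R\<close> and the identity.\<close>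
    have "Matrix.mat (d + N) (d + N) (\<lambda>(i, j). G $$ (if i < d then i + N else i - d, j)) =
        four_block_mat R (0\<^sub>m d N) V (1\<^sub>m N)"
      by (rule eq_matI) (auto simp: G_def R_def V_def add.commute)
    then show ?thesis
      using SG_car det_swap_rows[of G d N]
      by (simp add: R_def V_def add.commute det_four_block_mat_upper_right_zero[of _ d _ N])
  qed
  ultimately have e1: "(\<Prod>i<N. - T i (d + i)) * ((- 1) ^ (d * N) * Determinant.det R) = poly (charP T N) x"
    by (simp add: det_\<xi> det_S poly_charP K_def)
  have e2: "rec_det d F N N x = Determinant.det R"
    unfolding rec_det_def R_def by (intro arg_cong[of _ _ Determinant.det] eq_matI) auto
  have e3: "(\<Prod>i<N. - T i (d + i)) = (- 1) ^ N * (\<Prod>i<N. T i (d + i))"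
    by (simp add: prod_uminus)
  \<comment> \<open>The sign in \<open>beta\<close> collects both signs met here:
    \<open>(- 1) ^ N\<close> from the diagonal of \<open>S\<close> and
    \<open>(- 1) ^ (d * N)\<close> from the row exchange.\<close>
  have e4: "(- 1 :: real) ^ ((d - 1) * N) = (- 1) ^ N * (- 1) ^ (d * N)"
  proof -
    obtain e where "d = Suc e"
      using d gr0_conv_Suc by blast
    then show ?thesis
      by (simp add: power_add mult.assoc[symmetric] flip: power_mult_distrib)
  qed
  have "beta d T N * rec_det d F N N x =
      (- 1) ^ N * (\<Prod>i<N. T i (d + i)) * ((- 1) ^ (d * N) * Determinant.det R)"
    unfolding beta_def e2 e4 by (simp only: mult_ac)
  then show ?thesis
    using e1 e3 by simp
qed

text \<open>Row \<open>0\<close> repeats row \<open>l - N\<close>. Among the \<open>d\<close>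
  indices following \<open>N\<close>, only \<open>l = N + d\<close> can therefore contribute to a
  boundary term.\<close>

lemma rec_det_eq_0:
  assumes "N < l" "l < N + d"
  shows "rec_det d F l N x = 0"
proof -
  let ?M = "Matrix.mat d d (\<lambda>(i, j). poly (F j (if i = 0 then l else N + i)) x)"
  have "Matrix.row ?M 0 = Matrix.row ?M (l - N)"
    using assms by (intro eq_vecI) auto
  then show ?thesis
    unfolding rec_det_def using assms by (intro det_identical_rows[of _ d 0 "l - N"]) auto
qed

text \<open>The rows with indices \<open>N + d, N + 1, ..., N + d - 1\<close> are a cyclic
  rearrangement of those with indices \<open>N + 1, ..., N + d\<close>, and a cycle of length
  \<open>d\<close> has sign \<open>(- 1) ^ (d - 1)\<close>.\<close>

lemma rec_det_shift:
  assumes "0 < d"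
  shows "rec_det d F (N + d) N x = (- 1) ^ (d - 1) * rec_det d F (Suc N) (Suc N) x"
proof -
  obtain e where e: "d = e + 1"
    using assms by (metis Suc_eq_plus1 gr0_conv_Suc)
  let ?M = "Matrix.mat (e + 1) (e + 1) (\<lambda>(i, j). poly (F j (if i = 0 then N + (e + 1) else N + i)) x)"
  have "Determinant.det ?M = (- 1) ^ (e * 1) * Determinant.det (Matrix.mat (e + 1) (e + 1)
      (\<lambda>(i, j). ?M $$ (if i < e then i + 1 else i - e, j)))"
    by (rule det_swap_rows) simp
  also have "Matrix.mat (e + 1) (e + 1) (\<lambda>(i, j). ?M $$ (if i < e then i + 1 else i - e, j)) =
      Matrix.mat (e + 1) (e + 1) (\<lambda>(i, j). poly (F j (if i = 0 then Suc N else Suc N + i)) x)"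
  proof (rule eq_matI)
    fix i j
    assume "i < dim_row (Matrix.mat (e + 1) (e + 1)
        (\<lambda>(i, j). poly (F j (if i = 0 then Suc N else Suc N + i)) x))"
      and "j < dim_col (Matrix.mat (e + 1) (e + 1)
        (\<lambda>(i, j). poly (F j (if i = 0 then Suc N else Suc N + i)) x))"
    then have ij: "i < e + 1" "j < e + 1" by auto
    then have "(if i < e then i + 1 else i - e) < e + 1" by auto
    then have "?M $$ (if i < e then i + 1 else i - e, j) =
        poly (F j (if (if i < e then i + 1 else i - e) = 0 then N + (e + 1)
          else N + (if i < e then i + 1 else i - e))) x"
      using ij by (subst index_mat) auto
    then show "Matrix.mat (e + 1) (e + 1) (\<lambda>(i, j). ?M $$ (if i < e then i + 1 else i - e, j)) $$ (i, j) =
        Matrix.mat (e + 1) (e + 1) (\<lambda>(i, j). poly (F j (if i = 0 then Suc N else Suc N + i)) x) $$ (i, j)"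
      using ij by (auto simp: e less_Suc_eq)
  qed auto
  finally show ?thesis
    unfolding rec_det_def e by simp
qed

text \<open>Only the first row depends on \<open>n\<close>, so expanding along it gives cofactors
  that are the same for all \<open>n\<close>. Up to normalization these coefficients are the
  Christoffel numbers.\<close>

lemma rec_det_expansion:
  assumes "0 < d"
  obtains c where "\<And>n. rec_det d F n N x = (\<Sum>b<d. c b * poly (F b n) x)"
proof -
  define M where "M n = Matrix.mat d d (\<lambda>(i, j). poly (F j (if i = 0 then n else N + i)) x)" for n
  have "mat_delete (M n) 0 j = mat_delete (M 0) 0 j" for n j
    by (rule eq_matI) (auto simp: mat_delete_def M_def)
  then have "cofactor (M n) 0 j = cofactor (M 0) 0 j" for n j
    by (metis cofactor_def)
  moreover have "rec_det d F n N x = (\<Sum>j<d. M n $$ (0, j) * cofactor (M n) 0 j)" for n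
    unfolding rec_det_def M_def[symmetric]
    using assms by (intro laplace_expansion_row) (auto simp: M_def)
  ultimately have "rec_det d F n N x = (\<Sum>j<d. cofactor (M 0) 0 j * poly (F j n) x)" for n
    using assms by (auto simp: M_def mult.commute intro!: sum.cong)
  then show ?thesis by (rule that)
qed

lemma rec_det_recursion:
  assumes "0 < d" "right_recursion_polys d T \<xi> F"
  shows "(\<Sum>l\<le>n + d. T n l * rec_det d F l N x) = x * rec_det d F n N x"
proof -
  obtain c where c: "\<And>n. rec_det d F n N x = (\<Sum>b<d. c b * poly (F b n) x)"
    using rec_det_expansion[OF assms(1)] by blast
  have "(\<Sum>l\<le>n + d. T n l * rec_det d F l N x) =
      (\<Sum>b<d. c b * (\<Sum>l\<le>n + d. T n l * poly (F b l) x))"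
    by (simp add: c sum_distrib_left mult_ac) (rule sum.swap)
  also have "\<dots> = (\<Sum>b<d. c b * (x * poly (F b n) x))"
    using right_recursion_polys_eval[OF assms(2)] by simp
  finally show ?thesis
    by (simp add: c sum_distrib_left mult_ac)
qed

lemma beta_Suc: "beta d T (Suc N) = beta d T N * (- 1) ^ (d - 1) * T N (N + d)"
  by (simp add: beta_def power_add mult_ac add.commute)

text \<open>Of the terms cut off beyond \<open>N\<close>, those with \<open>l < N + d\<close> vanish
  by repeated rows, and the band leaves \<open>l = N + d\<close> only in the last row
  \<open>n = N\<close>. There the cyclic shift turns it into the next characteristic polynomial, so
  that its roots give eigenvectors of the truncation.\<close>

lemma beta_rec_det_truncated_recursion:
  assumes d: "0 < d" and band: "\<And>n m. n + d < m \<Longrightarrow> T n m = 0"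
    and \<xi>: "lower_unitriangular d \<xi>" and rec: "right_recursion_polys d T \<xi> F"
    and n: "n \<le> N"
  shows "(\<Sum>l\<le>N. T n l * (beta d T N * rec_det d F l N x)) =
    x * (beta d T N * rec_det d F n N x) - (if n = N then poly (charP T (Suc N)) x else 0)"
proof -
  let ?U = "\<lambda>l. beta d T N * rec_det d F l N x"
  have "x * ?U n = beta d T N * (\<Sum>l\<le>n + d. T n l * rec_det d F l N x)"
    by (simp add: rec_det_recursion[OF d rec])
  also have "\<dots> = (\<Sum>l\<le>n + d. T n l * ?U l)"
    by (simp add: sum_distrib_left mult_ac)
  also have "\<dots> = (\<Sum>l<Suc N + d. T n l * ?U l)"
    using band n by (intro banded_row_sum[symmetric]) auto
  also have "\<dots> = (\<Sum>l\<le>N. T n l * ?U l) + (\<Sum>l\<in>{Suc N..<Suc N + d}. T n l * ?U l)"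
    unfolding lessThan_atLeast0 atLeast0AtMost[symmetric] atLeastLessThanSuc_atLeastAtMost[symmetric]
    by (rule sum.atLeastLessThan_concat[symmetric]) auto
  also have "(\<Sum>l\<in>{Suc N..<Suc N + d}. T n l * ?U l) = (\<Sum>l\<in>{N + d}. T n l * ?U l)"
    using d rec_det_eq_0[of N _ d F x] by (intro sum.mono_neutral_right) auto
  also have "\<dots> = (if n = N then poly (charP T (Suc N)) x else 0)"
  proof (cases "n = N")
    case True
    have "T N (N + d) * ?U (N + d) = beta d T (Suc N) * rec_det d F (Suc N) (Suc N) x"
      by (simp add: rec_det_shift[OF d] beta_Suc mult_ac)
    then show ?thesis
      using True beta_rec_det_eq_charP[OF d band \<xi> rec, of "Suc N" x] by simp
  qed (use band n in auto)
  finally show ?thesis by simp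
qed

lemma continuous_rec_det: "continuous (at x) (rec_det d F n N)"
proof -
  have "rec_det d F n N = (\<lambda>x. \<Sum>\<pi>\<in>{\<pi>. \<pi> permutes {0..<d}}.
      signof \<pi> * (\<Prod>i = 0..<d. poly (F (\<pi> i) (if i = 0 then n else N + i)) x))"
    unfolding rec_det_def
    by (subst det_def'[of _ d]) (auto intro!: ext sum.cong prod.cong simp: permutes_in_image)
  then show ?thesis by (auto intro!: continuous_intros)
qed

text \<open>This recovers the coefficients of a combination of recursion polynomials from its first
  \<open>d\<close> values, which is how the Christoffel numbers are identified.\<close>

lemma mat_inverse_mult_vec:
  assumes \<nu>: "lower_unitriangular d \<nu>"
    and v: "\<And>n. n < d \<Longrightarrow> v n = (\<Sum>b<d. c b * \<nu> $$ (n, b))" and "b < d"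
  shows "vec_index (the (mat_inverse \<nu>) *\<^sub>v Matrix.vec d v) b = c b"
proof -
  have car: "\<nu> \<in> carrier_mat d d"
    using \<nu> by (simp add: lower_unitriangular_def)
  have "Determinant.det \<nu> \<noteq> 0"
    using det_lower_unitriangular[OF \<nu>] by simp
  then have "\<nu> \<in> Units (ring_mat TYPE(real) d ())"
    by (rule det_non_zero_imp_unit[OF car])
  then obtain B where B: "mat_inverse \<nu> = Some B"
    using mat_inverse(1)[OF car, where b = "()"] by (metis option.exhaust)
  then have inv: "B * \<nu> = 1\<^sub>m d" "B \<in> carrier_mat d d"
    using mat_inverse(2)[OF car] by auto
  have "Matrix.vec d v = \<nu> *\<^sub>v Matrix.vec d c"
    using car by (intro eq_vecI) (auto simp: v scalar_prod_def lessThan_atLeast0 mult.commute)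
  then have "B *\<^sub>v Matrix.vec d v = (B * \<nu>) *\<^sub>v Matrix.vec d c"
    using inv car by (metis assoc_mult_mat_vec vec_carrier)
  then show ?thesis
    using B inv \<open>b < d\<close> by simp
qed

lemma decreasing_eigenvalues_inj:
  assumes "decreasing_eigenvalues T lam"
  shows "inj_on (lam N) {..N}"
proof -
  have *: "lam N (j + Suc i) < lam N j" if "j + Suc i \<le> N" for i j
    using that
  proof (induction i)
    case 0
    then show ?case using assms by (simp add: decreasing_eigenvalues_def)
  next
    case (Suc i)
    then have "lam N (Suc (j + Suc i)) < lam N (j + Suc i)" "lam N (j + Suc i) < lam N j"
      using assms by (auto simp: decreasing_eigenvalues_def)
    then show ?case by simp
  qed
  have "lam N k < lam N j" if "j < k" "k \<le> N" for j k
    using *[of j "k - Suc j"] that by simp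
  then show ?thesis
    by (intro inj_onI) (metis atMost_iff linorder_neqE_nat order_less_irrefl)
qed

lemma decreasing_eigenvalues_root:
  assumes "decreasing_eigenvalues T lam" "k \<le> N"
  shows "poly (charP T (Suc N)) (lam N k) = 0"
proof -
  have "eigenvalue (leading_section T (Suc N)) (lam N k)"
    using assms by (auto simp: decreasing_eigenvalues_def)
  then show ?thesis
    using eigenvalue_root_char_poly[OF leading_section_carrier] by (simp add: charP_def)
qed

subsection \<open>Biorthonormal eigenvectors of the truncations\<close>

locale banded_recursion =
  fixes p q :: nat and T :: inf_mat and \<nu> \<xi> :: "real mat"
    and A B :: "nat \<Rightarrow> nat \<Rightarrow> real poly"
  assumes p: "0 < p" and q: "0 < q"
    and upper_band: "\<And>n m. n + q < m \<Longrightarrow> T n m = 0"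
    and lower_band: "\<And>n m. m + p < n \<Longrightarrow> T n m = 0"
    and \<nu>: "lower_unitriangular p \<nu>" and \<xi>: "lower_unitriangular q \<xi>"
    and left: "left_recursion_polys p T \<nu> A" and right: "right_recursion_polys q T \<xi> B"
begin

definition U :: "nat \<Rightarrow> real \<Rightarrow> nat \<Rightarrow> real" where
  "U N x n = beta q T N * rec_det q B n N x"

text \<open>The numerator of \<open>w_entry\<close>. Leaving out the normalizing denominator keeps
  the Christoffel-Darboux identity free of division.\<close>

definition W :: "nat \<Rightarrow> real \<Rightarrow> nat \<Rightarrow> real" where
  "W N x n = alpha p T N * rec_det p A n N x"

lemma U_truncated:
  "n \<le> N \<Longrightarrow> (\<Sum>l\<le>N. T n l * U N x l) =
    x * U N x n - (if n = N then poly (charP T (Suc N)) x else 0)"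
  unfolding U_def by (rule beta_rec_det_truncated_recursion[OF q upper_band \<xi> right])

lemma W_truncated:
  "n \<le> N \<Longrightarrow> (\<Sum>l\<le>N. T l n * W N x l) =
    x * W N x n - (if n = N then poly (charP T (Suc N)) x else 0)"
  using beta_rec_det_truncated_recursion[OF p, of "\<lambda>n m. T m n" \<nu> A n N x] \<nu> left lower_band
  by (simp add: W_def alpha_transpose charP_transpose[of T] left_recursion_polys_transpose)

lemma W_diag: "W N x N = poly (charP T N) x"
  using beta_rec_det_eq_charP[OF p, of "\<lambda>n m. T m n" \<nu> A N x] \<nu> left lower_band
  by (simp add: W_def alpha_transpose charP_transpose[of T] left_recursion_polys_transpose)

text \<open>The truncation is applied between the left vector at \<open>y\<close> and the right
  vector at \<open>x\<close> in two ways: it acts on the left vector exactly as \<open>y\<close>,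
  and on the right vector as \<open>x\<close> up to a defect in the last component, where
  \<open>W_diag\<close> evaluates the left factor.\<close>

lemma christoffel_darboux:
  assumes y: "poly (charP T (Suc N)) y = 0"
  shows "(x - y) * (\<Sum>n\<le>N. W N y n * U N x n) = poly (charP T N) y * poly (charP T (Suc N)) x"
proof -
  have "(\<Sum>l\<le>N. T l n * W N y l) = y * W N y n" if "n \<le> N" for n
    using W_truncated[OF that, of y] y by simp
  then have "y * (\<Sum>n\<le>N. W N y n * U N x n) = (\<Sum>n\<le>N. (\<Sum>l\<le>N. T l n * W N y l) * U N x n)"
    by (simp add: sum_distrib_left mult_ac)
  also have "\<dots> = (\<Sum>n\<le>N. \<Sum>l\<le>N. T l n * W N y l * U N x n)"
    by (simp add: sum_distrib_right)
  also have "\<dots> = (\<Sum>l\<le>N. \<Sum>n\<le>N. T l n * W N y l * U N x n)"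
    by (rule sum.swap)
  also have "\<dots> = (\<Sum>l\<le>N. W N y l * (\<Sum>n\<le>N. T l n * U N x n))"
    by (simp add: sum_distrib_left mult_ac)
  also have "\<dots> = (\<Sum>l\<le>N. x * (W N y l * U N x l) -
      (if l = N then W N y N * poly (charP T (Suc N)) x else 0))"
    by (intro sum.cong) (auto simp: U_truncated algebra_simps)
  also have "\<dots> = x * (\<Sum>n\<le>N. W N y n * U N x n) - W N y N * poly (charP T (Suc N)) x"
    by (simp add: sum_subtractf sum_distrib_left)
  finally show ?thesis
    by (simp add: W_diag algebra_simps)
qed

text \<open>Divide the identity by \<open>x - y\<close> and let \<open>x\<close> tend to
  \<open>y\<close>: the left side is continuous, and the difference quotient of the characteristic
  polynomial at its root tends to the derivative.\<close>

lemma christoffel_darboux_confluent: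
  assumes y: "poly (charP T (Suc N)) y = 0"
  shows "(\<Sum>n\<le>N. W N y n * U N y n) = poly (charP T N) y * poly (pderiv (charP T (Suc N))) y"
proof -
  let ?P = "charP T (Suc N)"
  let ?g = "\<lambda>x. \<Sum>n\<le>N. W N y n * U N x n"
  have "continuous (at y) ?g"
    unfolding U_def by (intro continuous_intros continuous_rec_det)
  then have 1: "?g \<midarrow>y\<rightarrow> ?g y"
    by (simp add: isCont_def)
  have 2: "(\<lambda>x. poly (charP T N) y * ((poly ?P x - poly ?P y) / (x - y))) \<midarrow>y\<rightarrow>
      poly (charP T N) y * poly (pderiv ?P) y"
    using poly_DERIV[of ?P y] by (intro tendsto_mult_left) (simp add: has_field_derivative_iff)
  have 3: "\<forall>\<^sub>F x in at y. ?g x = poly (charP T N) y * ((poly ?P x - poly ?P y) / (x - y))"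
  proof (rule eventually_at_topological[THEN iffD2], intro exI[of _ UNIV] conjI ballI impI)
    fix x assume "x \<noteq> y"
    then show "?g x = poly (charP T N) y * ((poly ?P x - poly ?P y) / (x - y))"
      using christoffel_darboux[OF y, of x] unfolding y by (simp add: eq_divide_eq mult.commute)
  qed auto
  show ?thesis
    by (rule LIM_unique[OF 1]) (rule tendsto_cong[OF 3, THEN iffD2, OF 2])
qed

context
  fixes lam :: "nat \<Rightarrow> nat \<Rightarrow> real" and N :: nat
  assumes lam: "decreasing_eigenvalues T lam"
    and simple: "\<And>k. k \<le> N \<Longrightarrow>
      poly (charP T N) (lam N k) * poly (pderiv (charP T (Suc N))) (lam N k) \<noteq> 0"
begin

text \<open>For distinct eigenvalues the right side of the Christoffel-Darboux identity vanishes;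
  for equal ones the confluent form is exactly the denominator of \<open>w_entry\<close>.\<close>

lemma biorthonormal:
  assumes "k \<le> N" "l \<le> N"
  shows "(\<Sum>n\<le>N. w_entry p T A lam N k n * u_entry q T B lam N l n) = (if k = l then 1 else 0)"
proof -
  let ?c = "poly (charP T N) (lam N k) * poly (pderiv (charP T (Suc N))) (lam N k)"
  have "(\<Sum>n\<le>N. w_entry p T A lam N k n * u_entry q T B lam N l n) =
      (\<Sum>n\<le>N. W N (lam N k) n * U N (lam N l) n) / ?c"
    by (simp add: w_entry_def u_entry_def W_def U_def sum_divide_distrib)
  also have "\<dots> = (if k = l then 1 else 0)"
  proof (cases "k = l")
    case True
    then show ?thesis
      using christoffel_darboux_confluent[OF decreasing_eigenvalues_root[OF lam assms(1)]]
        simple[OF assms(1)] by simp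
  next
    case False
    then have "lam N l \<noteq> lam N k"
      using decreasing_eigenvalues_inj[OF lam, of N] assms by (auto dest: inj_onD)
    then show ?thesis
      using christoffel_darboux[OF decreasing_eigenvalues_root[OF lam assms(1)], of "lam N l"]
        decreasing_eigenvalues_root[OF lam assms(2)] False by simp
  qed
  finally show ?thesis .
qed

text \<open>Biorthonormality says that one square matrix is a left inverse of another, hence also a
  right inverse. The resulting sum over eigenvalues is the one that becomes an integral against the
  discrete measures.\<close>

lemma biorthonormal_dual:
  assumes "n \<le> N" "m \<le> N"
  shows "(\<Sum>k\<le>N. u_entry q T B lam N k n * w_entry p T A lam N k m) = (if n = m then 1 else 0)"
proof -
  let ?M = "Suc N"
  define Um where "Um = Matrix.mat ?M ?M (\<lambda>(n, k). u_entry q T B lam N k n)"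
  define Wm where "Wm = Matrix.mat ?M ?M (\<lambda>(k, n). w_entry p T A lam N k n)"
  have car: "Um \<in> carrier_mat ?M ?M" "Wm \<in> carrier_mat ?M ?M"
    by (auto simp: Um_def Wm_def)
  have range: "{0..<?M} = {..N}" by auto
  have "Wm * Um = 1\<^sub>m ?M"
  proof (rule eq_matI)
    fix i j assume "i < dim_row (1\<^sub>m ?M)" "j < dim_col (1\<^sub>m ?M)"
    then have ij: "i < ?M" "j < ?M" by simp_all
    then have "(Wm * Um) $$ (i, j) = (\<Sum>n\<le>N. w_entry p T A lam N i n * u_entry q T B lam N j n)"
      by (simp add: Um_def Wm_def scalar_prod_def flip: range)
    then show "(Wm * Um) $$ (i, j) = 1\<^sub>m ?M $$ (i, j)"
      using ij biorthonormal[of i j] by simp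
  qed (use car in simp_all)
  then have "Um * Wm = 1\<^sub>m ?M"
    by (rule mat_mult_left_right_inverse[OF car(2,1)])
  then have "(Um * Wm) $$ (n, m) = (if n = m then 1 else 0)"
    using assms by simp
  moreover have "(Um * Wm) $$ (n, m) = (\<Sum>k\<le>N. u_entry q T B lam N k n * w_entry p T A lam N k m)"
    using assms by (simp add: Um_def Wm_def scalar_prod_def flip: range)
  ultimately show ?thesis by simp
qed

text \<open>Evaluate the eigenvalue equation at a component of largest modulus of the right
  eigenvector, which is nonzero by biorthonormality; the truncated rows have sum at most
  \<open>1\<close>. The bound is what permits clamping the test functions below.\<close>

lemma abs_eigenvalue_le_1:
  assumes T: "stochastic T" and k: "k \<le> N"
  shows "\<bar>lam N k\<bar> \<le> 1"
proof -
  let ?x = "lam N k"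
  let ?v = "\<lambda>n. \<bar>U N ?x n\<bar>"
  obtain n where n: "n \<le> N" "\<And>l. l \<le> N \<Longrightarrow> ?v l \<le> ?v n"
    using Max_in[of "?v ` {..N}"] Max_ge[of "?v ` {..N}"] by fastforce
  have "?v n \<noteq> 0"
  proof
    assume "?v n = 0"
    then have "U N ?x l = 0" if "l \<le> N" for l
      using n(2)[OF that] by simp
    then have "u_entry q T B lam N k l = 0" if "l \<le> N" for l
      using that by (simp only: u_entry_def U_def)
    then show False
      using biorthonormal[OF k k] by simp
  qed
  have nn: "0 \<le> T i j" for i j
    using T by (simp add: stochastic_def)
  have "\<bar>?x\<bar> * ?v n = \<bar>\<Sum>l\<le>N. T n l * U N ?x l\<bar>"
    using U_truncated[OF n(1), of ?x] decreasing_eigenvalues_root[OF lam k] by (simp add: abs_mult)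
  also have "\<dots> \<le> (\<Sum>l\<le>N. T n l * ?v l)"
    using sum_abs[of "\<lambda>l. T n l * U N ?x l" "{..N}"] nn by (simp add: abs_mult)
  also have "\<dots> \<le> (\<Sum>l\<le>N. T n l * ?v n)"
    using n nn by (intro sum_mono mult_left_mono) auto
  also have "\<dots> = (\<Sum>l\<le>N. T n l) * ?v n"
    by (simp add: sum_distrib_right)
  also have "\<dots> \<le> 1 * ?v n"
  proof (intro mult_right_mono)
    have "T n sums 1"
      using T by (simp add: stochastic_def)
    then show "(\<Sum>l\<le>N. T n l) \<le> 1"
      using nn by (metis sum_le_suminf sums_summable sums_unique finite_atMost)
  qed simp
  finally show ?thesis
    using \<open>?v n \<noteq> 0\<close> by simp
qed

end

text \<open>The first \<open>q\<close> polynomials are the constants in \<open>\<xi>\<close>, so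
  multiplying the first \<open>q\<close> entries by its inverse returns the cofactor coefficients,
  and these serve for every \<open>n\<close>.\<close>

lemma u_entry_expansion:
  "u_entry q T B lam N k n = (\<Sum>b<q. christoffel_rho q T \<xi> B lam N k b * poly (B b n) (lam N k))"
proof -
  obtain c where c: "\<And>n. rec_det q B n N (lam N k) = (\<Sum>b<q. c b * poly (B b n) (lam N k))"
    using rec_det_expansion[OF q] by blast
  have *: "u_entry q T B lam N k n = (\<Sum>b<q. (beta q T N * c b) * poly (B b n) (lam N k))" for n
    by (simp add: u_entry_def c sum_distrib_left mult_ac)
  have "poly (B b n) x = \<xi> $$ (n, b)" if "b < q" "n < q" for b n x
    using right that by (simp add: right_recursion_polys_def)
  then have "christoffel_rho q T \<xi> B lam N k b = beta q T N * c b" if "b < q" for b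
    unfolding christoffel_rho_def using that
    by (intro mat_inverse_mult_vec[OF \<xi>]) (simp_all add: *)
  then show ?thesis
    by (simp add: *)
qed

lemma w_entry_expansion:
  "w_entry p T A lam N k n = (\<Sum>a<p. christoffel_mu p T \<nu> A lam N k a * poly (A a n) (lam N k))"
proof -
  obtain c where c: "\<And>n. rec_det p A n N (lam N k) = (\<Sum>b<p. c b * poly (A b n) (lam N k))"
    using rec_det_expansion[OF p] by blast
  define e where "e = alpha p T N /
    (poly (charP T N) (lam N k) * poly (pderiv (charP T (Suc N))) (lam N k))"
  have *: "w_entry p T A lam N k n = (\<Sum>b<p. (e * c b) * poly (A b n) (lam N k))" for n
    by (simp add: w_entry_def c sum_distrib_left e_def sum_divide_distrib mult_ac)
  have "poly (A b n) x = \<nu> $$ (n, b)" if "b < p" "n < p" for b n x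
    using left that by (simp add: left_recursion_polys_def)
  then have "christoffel_mu p T \<nu> A lam N k b = e * c b" if "b < p" for b
    unfolding christoffel_mu_def using that
    by (intro mat_inverse_mult_vec[OF \<nu>]) (simp_all add: *)
  then show ?thesis
    by (simp add: *)
qed

text \<open>Division by zero yields zero, so all entries of \<open>w_entry\<close> vanish.
  Positivity of the Christoffel numbers thereby forces the denominators to be nonzero.\<close>

lemma christoffel_mu_eq_0:
  assumes "poly (charP T N) (lam N k) * poly (pderiv (charP T (Suc N))) (lam N k) = 0" "a < p"
  shows "christoffel_mu p T \<nu> A lam N k a = 0"
  unfolding christoffel_mu_def
  using mat_inverse_mult_vec[OF \<nu> _ \<open>a < p\<close>, of "w_entry p T A lam N k" "\<lambda>_. 0"] assms(1)
  by (simp add: w_entry_def)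

end

subsection \<open>Powers of a banded stochastic matrix\<close>

text \<open>For \<open>T\<close> with \<open>q\<close> superdiagonals this is the matrix power with
  the first step split off; the cut-off at \<open>n + q\<close> then loses nothing and keeps the
  sums finite.\<close>

primrec transition_power :: "nat \<Rightarrow> inf_mat \<Rightarrow> nat \<Rightarrow> inf_mat" where
  "transition_power q T 0 = (\<lambda>n m. if n = m then 1 else 0)"
| "transition_power q T (Suc k) = (\<lambda>n m. \<Sum>l\<le>n + q. T n l * transition_power q T k l m)"

locale banded_stochastic =
  fixes p q :: nat and T :: inf_mat
  assumes stochastic: "stochastic T"
    and upper_band: "\<And>n m. n + q < m \<Longrightarrow> T n m = 0"
    and lower_band: "\<And>n m. m + p < n \<Longrightarrow> T n m = 0"
begin

abbreviation P :: "nat \<Rightarrow> nat \<Rightarrow> nat \<Rightarrow> real" where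
  "P \<equiv> transition_power q T"

lemma nonneg: "0 \<le> T n m"
  using stochastic by (simp add: stochastic_def)

lemma row_sum: "(\<Sum>l\<le>n + q. T n l) = 1"
proof -
  have "T n sums (\<Sum>l\<le>n + q. T n l)"
    using upper_band by (intro sums_finite) auto
  then show ?thesis
    using stochastic sums_unique2 unfolding stochastic_def by blast
qed

lemma transition_power_nonneg: "0 \<le> P k n m"
  by (induction k arbitrary: n) (auto intro!: sum_nonneg mult_nonneg_nonneg nonneg)

lemma transition_power_eq_0: "n + k * q < m \<Longrightarrow> P k n m = 0"
proof (induction k arbitrary: n)
  case (Suc k)
  then have "P k l m = 0" if "l \<le> n + q" for l
    using that by simp
  then show ?case by simp
qed simp

text \<open>Chapman-Kolmogorov. The cut-off \<open>M\<close> is any bound on the states reachable in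
  \<open>j\<close> steps, which lets different sums share one range.\<close>

lemma transition_power_add: "n + j * q \<le> M \<Longrightarrow> P (j + k) n m = (\<Sum>l\<le>M. P j n l * P k l m)"
proof (induction j arbitrary: n)
  case 0
  have "(\<Sum>l\<le>M. P 0 n l * P k l m) = (\<Sum>l\<le>M. if l = n then P k l m else 0)"
    by (intro sum.cong) auto
  then show ?case using 0 by simp
next
  case (Suc j)
  have "P (Suc j + k) n m = (\<Sum>i\<le>n + q. T n i * (\<Sum>l\<le>M. P j i l * P k l m))"
    using Suc by simp
  also have "\<dots> = (\<Sum>i\<le>n + q. \<Sum>l\<le>M. T n i * P j i l * P k l m)"
    by (simp add: sum_distrib_left mult_ac)
  also have "\<dots> = (\<Sum>l\<le>M. \<Sum>i\<le>n + q. T n i * P j i l * P k l m)"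
    by (rule sum.swap)
  also have "\<dots> = (\<Sum>l\<le>M. P (Suc j) n l * P k l m)"
    by (simp add: sum_distrib_right)
  finally show ?case .
qed

lemma transition_power_1: "P 1 n m = T n m"
proof -
  have "P 1 n m = (\<Sum>l\<le>n + q. if l = m then T n m else 0)"
    unfolding One_nat_def transition_power.simps by (intro sum.cong) auto
  then show ?thesis
    using upper_band[of n m] by simp
qed

text \<open>Splitting off the last step gives, by the lower band, a sum whose range does not depend
  on \<open>k\<close>, so limits in \<open>k\<close> can be taken termwise.\<close>

lemma transition_power_Suc_right: "P (Suc k) n m = (\<Sum>l\<le>m + p. P k n l * T l m)"
proof -
  have "P (k + 1) n m = (\<Sum>l\<le>max (n + k * q) (m + p). P k n l * P 1 l m)"
    by (rule transition_power_add) simp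
  also have "\<dots> = (\<Sum>l\<le>m + p. P k n l * T l m)"
    unfolding transition_power_1 using lower_band by (intro sum.mono_neutral_right) auto
  finally show ?thesis by simp
qed

lemma transition_power_row_sum: "n + k * q \<le> M \<Longrightarrow> (\<Sum>m\<le>M. P k n m) = 1"
proof (induction k arbitrary: n)
  case 0
  then show ?case by simp
next
  case (Suc k)
  have "(\<Sum>m\<le>M. P (Suc k) n m) = (\<Sum>l\<le>n + q. \<Sum>m\<le>M. T n l * P k l m)"
    unfolding transition_power.simps by (rule sum.swap)
  also have "\<dots> = (\<Sum>l\<le>n + q. T n l * (\<Sum>m\<le>M. P k l m))"
    by (simp add: sum_distrib_left)
  also have "\<dots> = 1"
    using Suc row_sum by simp
  finally show ?case .
qed

lemma transition_power_partial_row_sum: "(\<Sum>m\<le>K. P k n m) \<le> 1"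
proof -
  have "(\<Sum>m\<le>K. P k n m) \<le> (\<Sum>m\<le>max K (n + k * q). P k n m)"
    by (intro sum_mono2) (auto intro: transition_power_nonneg)
  then show ?thesis
    using transition_power_row_sum[of n k] by simp
qed

text \<open>
  \<open>avoid i t n\<close> is the probability that the chain started at \<open>n\<close> is not at \<open>i\<close> at the times \<open>1, \<dots>, t\<close>.
\<close>

primrec avoid :: "nat \<Rightarrow> nat \<Rightarrow> nat \<Rightarrow> real" where
  "avoid i 0 n = 1"
| "avoid i (Suc t) n = (\<Sum>l\<le>n + q. if l = i then 0 else T n l * avoid i t l)"

lemma avoid_nonneg: "0 \<le> avoid i t n"
  by (induction t arbitrary: n) (auto intro!: sum_nonneg mult_nonneg_nonneg nonneg)

lemma avoid_le_1: "avoid i t n \<le> 1"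
proof (induction t arbitrary: n)
  case (Suc t)
  have "avoid i (Suc t) n \<le> (\<Sum>l\<le>n + q. T n l)"
    using Suc nonneg by (auto intro!: sum_mono mult_left_le)
  then show ?case by (simp add: row_sum)
qed simp

lemma avoid_decreasing: "avoid i (Suc t) n \<le> avoid i t n"
proof (induction t arbitrary: n)
  case 0
  show ?case using avoid_le_1[of i "Suc 0" n] by simp
next
  case (Suc t)
  show ?case
    unfolding avoid.simps(2)[of i "Suc t"] avoid.simps(2)[of i t]
    using Suc nonneg by (auto intro!: sum_mono mult_left_mono)
qed

text \<open>One step is moved from the avoidance probability to the power; the exclusion of
  \<open>i\<close> at that step becomes the subtracted term.\<close>

lemma avoid_step:
  assumes "n + k * q \<le> M"
  shows "(\<Sum>l\<le>M. P k n l * avoid i (Suc t) l) =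
    (\<Sum>l\<le>M + q. P (Suc k) n l * avoid i t l) - P (Suc k) n i * avoid i t i"
proof -
  have Pk: "P (Suc k) n j = (\<Sum>l\<le>M. P k n l * T l j)" for j
    using transition_power_add[OF assms, of 1 j] by (simp only: transition_power_1 add.commute[of k] plus_1_eq_Suc)
  have "(\<Sum>l\<le>M. P k n l * avoid i (Suc t) l) =
      (\<Sum>l\<le>M. \<Sum>j\<le>M + q. P k n l * (if j = i then 0 else T l j * avoid i t j))"
  proof (intro sum.cong refl)
    fix l assume "l \<in> {..M}"
    then have "avoid i (Suc t) l = (\<Sum>j\<le>M + q. if j = i then 0 else T l j * avoid i t j)"
      unfolding avoid.simps using upper_band by (intro sum.mono_neutral_left) auto
    then show "P k n l * avoid i (Suc t) l =
        (\<Sum>j\<le>M + q. P k n l * (if j = i then 0 else T l j * avoid i t j))"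
      by (simp only: sum_distrib_left)
  qed
  also have "\<dots> = (\<Sum>j\<le>M + q. \<Sum>l\<le>M. P k n l * (if j = i then 0 else T l j * avoid i t j))"
    by (rule sum.swap)
  also have "\<dots> = (\<Sum>j\<le>M + q. P (Suc k) n j * avoid i t j -
      (if j = i then P (Suc k) n i * avoid i t i else 0))"
    unfolding Pk by (intro sum.cong) (auto simp: sum_distrib_left sum_distrib_right mult_ac)
  also have "\<dots> = (\<Sum>j\<le>M + q. P (Suc k) n j * avoid i t j) - P (Suc k) n i * avoid i t i"
  proof (cases "i \<le> M + q")
    case False
    then have "P (Suc k) n i = 0"
      using assms by (intro transition_power_eq_0) simp
    then show ?thesis using False by (simp add: sum_subtractf)
  qed (simp add: sum_subtractf)
  finally show ?thesis .
qed

text \<open>Decomposition of the paths of length \<open>t\<close> at their last visit to \<open>i\<close>.\<close>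

lemma last_visit:
  "(\<Sum>s<t. P (Suc s) n i * avoid i (t - Suc s) i) = 1 - avoid i t n"
proof -
  \<comment> \<open>The state of the computation after \<open>r\<close> such moves. At
    \<open>r = t\<close> the remaining factor is \<open>avoid i 0 l = 1\<close>, so the first sum is
    a full row sum.\<close>
  have *: "avoid i t n = (\<Sum>l\<le>n + r * q. P r n l * avoid i (t - r) l) -
      (\<Sum>s<r. P (Suc s) n i * avoid i (t - Suc s) i)" if "r \<le> t" for r
    using that
  proof (induction r)
    case 0
    have "(\<Sum>l\<le>n + 0 * q. P 0 n l * avoid i (t - 0) l) = (\<Sum>l\<le>n. if l = n then avoid i t l else 0)"
      by (intro sum.cong) auto
    then show ?case by simp
  next
    case (Suc r)
    then have "avoid i (t - r) l = avoid i (Suc (t - Suc r)) l" for l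
      by (simp add: Suc_diff_Suc)
    then show ?case
      using Suc avoid_step[of n r "n + r * q" i "t - Suc r"] by (simp add: add_ac del: transition_power.simps avoid.simps)
  qed
  show ?thesis
    using *[of t] transition_power_row_sum[of n t "n + t * q"] by simp
qed

end

subsection \<open>The spectral representation\<close>

lemma integral_discrete_measure:
  fixes f :: "real \<Rightarrow> real"
  assumes "\<And>k. k \<le> N \<Longrightarrow> 0 \<le> christoffel_rho q T \<xi> B lam N k b * christoffel_mu p T \<nu> A lam N k a"
    and "f \<in> borel_measurable borel"
  shows "integral\<^sup>L (discrete_measure p q T \<nu> \<xi> A B lam N b a) f =
    (\<Sum>k\<le>N. christoffel_rho q T \<xi> B lam N k b * christoffel_mu p T \<nu> A lam N k a * f (lam N k))"
proof -
  have "integral\<^sup>L (discrete_measure p q T \<nu> \<xi> A B lam N b a) f =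
      (\<integral>k. f (lam N k) \<partial>point_measure {..N}
        (\<lambda>k. ennreal (christoffel_rho q T \<xi> B lam N k b * christoffel_mu p T \<nu> A lam N k a)))"
    unfolding discrete_measure_def using assms(2) by (intro integral_distr) simp_all
  also have "\<dots> = (\<Sum>k\<le>N. (christoffel_rho q T \<xi> B lam N k b * christoffel_mu p T \<nu> A lam N k a) *\<^sub>R
      f (lam N k))"
    using assms(1) by (intro lebesgue_integral_point_measure_finite) blast+
  finally show ?thesis by simp
qed

section \<open>Moments of finite measures on the unit interval\<close>

locale unit_interval_measure =
  fixes \<psi> :: "real measure"
  assumes sets: "sets \<psi> = sets borel" and finite: "finite_measure \<psi>"
    and null: "emeasure \<psi> (- {0..1}) = 0"
begin

lemma AE_unit_interval: "AE x in \<psi>. x \<in> {0..1}"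
  using null by (intro AE_I'[of "- {0..1}"]) (auto simp: sets null_sets_def)

lemma integrable_continuous:
  fixes f :: "real \<Rightarrow> real"
  assumes f: "continuous_on UNIV f"
  shows "integrable \<psi> f"
proof -
  have "compact (f ` {0..1})"
    using f by (intro compact_continuous_image continuous_on_subset[OF f]) auto
  then obtain C where C: "\<And>y. y \<in> f ` {0..1} \<Longrightarrow> norm y \<le> C"
    using compact_imp_bounded bounded_iff by metis
  interpret finite_measure \<psi> by (rule finite)
  show ?thesis
  proof (rule integrable_const_bound[of _ C])
    show "AE x in \<psi>. norm (f x) \<le> C"
      using AE_unit_interval by eventually_elim (use C in auto)
    show "f \<in> borel_measurable \<psi>"
      using borel_measurable_continuous_onI[OF f] measurable_cong_sets[OF sets refl] by blast
  qed
qed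

text \<open>On \<open>[0,1]\<close> the powers of \<open>x\<close> decrease to the indicator of the
  point \<open>1\<close>, so dominated convergence with bound \<open>\<bar>g x\<bar>\<close> leaves
  only the atom there.\<close>

lemma moments_tendsto_mass_at_1:
  fixes g :: "real \<Rightarrow> real"
  assumes g: "continuous_on UNIV g"
  shows "(\<lambda>k. \<integral>x. x ^ k * g x \<partial>\<psi>) \<longlonglongrightarrow> measure \<psi> {1} * g 1"
proof -
  interpret finite_measure \<psi> by (rule finite)
  have 1: "{1} \<in> sets \<psi>"
    by (simp add: sets)
  have "(\<lambda>k. \<integral>x. x ^ k * g x \<partial>\<psi>) \<longlonglongrightarrow> (\<integral>x. indicator {1} x * g 1 \<partial>\<psi>)"
  proof (rule integral_dominated_convergence[where w = "\<lambda>x. \<bar>g x\<bar>"])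
    show "integrable \<psi> (\<lambda>x. \<bar>g x\<bar>)"
      by (intro integrable_continuous continuous_intros g)
    show "AE x in \<psi>. (\<lambda>k. x ^ k * g x) \<longlonglongrightarrow> indicator {1} x * g 1"
      using AE_unit_interval
    proof eventually_elim
      case (elim x)
      show ?case
      proof (cases "x = 1")
        case False
        then have "(\<lambda>k. x ^ k * g x) \<longlonglongrightarrow> 0 * g x"
          using elim by (intro tendsto_mult tendsto_const LIMSEQ_power_zero) auto
        then show ?thesis using False by simp
      qed simp
    qed
    show "AE x in \<psi>. norm (x ^ k * g x) \<le> \<bar>g x\<bar>" for k
      using AE_unit_interval
      by eventually_elim (auto simp: abs_mult power_le_one intro!: mult_left_le_one_le)
    show "(\<lambda>x. indicator {1} x * g 1) \<in> borel_measurable \<psi>"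
      using 1 by measurable
    show "(\<lambda>x. x ^ k * g x) \<in> borel_measurable \<psi>" for k
      by (intro borel_measurable_integrable integrable_continuous continuous_intros g)
  qed
  also have "(\<integral>x. indicator {1} x * g 1 \<partial>\<psi>) = measure \<psi> {1} * g 1"
    using 1 sets_eq_imp_space_eq[OF sets] by (simp add: emeasure_eq_measure)
  finally show ?thesis .
qed

end

section \<open>Passage to the weak limit and the spectral formula for powers\<close>

locale spectral_chain = banded_recursion +
  fixes lam :: "nat \<Rightarrow> nat \<Rightarrow> real" and \<psi> :: "nat \<Rightarrow> nat \<Rightarrow> real measure"
  assumes stochastic: "stochastic T"
    and lam: "decreasing_eigenvalues T lam"
    and positive: "christoffel_positive p q T \<nu> \<xi> A B lam"
    and spectral: "spectral_measures p q T \<nu> \<xi> A B lam \<psi>"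
begin

lemma unit_interval_measure: "b < q \<Longrightarrow> a < p \<Longrightarrow> unit_interval_measure (\<psi> b a)"
  using spectral by (simp add: spectral_measures_def unit_interval_measure_def)

text \<open>This is the weak limit of the dual biorthonormality relations, whose value is already
  the final one as soon as \<open>N\<close> is large.\<close>

lemma spectral_orthogonality:
  "(\<Sum>b<q. \<Sum>a<p. \<integral>x. poly (B b n) x * poly (A a m) x \<partial>\<psi> b a) = (if n = m then 1 else 0)"
proof -
  obtain r :: "nat \<Rightarrow> nat" where r: "strict_mono r"
    and conv: "\<And>b a. b < q \<Longrightarrow> a < p \<Longrightarrow>
      converges_weakly (\<lambda>j. discrete_measure p q T \<nu> \<xi> A B lam (r j) b a) (\<psi> b a)"
    using spectral by (auto simp: spectral_measures_def)
  \<comment> \<open>Weak convergence is tested on bounded functions. Clamping the argument to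
    \<open>[-1,1]\<close> makes the polynomials bounded and changes them neither at the eigenvalues
    nor on \<open>[0,1]\<close>, where the limit measures live.\<close>
  define cl :: "real \<Rightarrow> real" where "cl x = max (- 1) (min 1 x)" for x
  have cl: "cl x = x" if "\<bar>x\<bar> \<le> 1" for x
    using that by (auto simp: cl_def)
  define f where "f b a x = poly (B b n) (cl x) * poly (A a m) (cl x)" for b a x
  have cont: "continuous_on UNIV (f b a)" for b a
    unfolding f_def cl_def by (intro continuous_intros)
  have bdd: "bounded (range (f b a))" for b a
  proof -
    have "compact ((\<lambda>x. poly (B b n) x * poly (A a m) x) ` {-1..1})"
      by (intro compact_continuous_image continuous_intros) auto
    moreover have "range (f b a) \<subseteq> (\<lambda>x. poly (B b n) x * poly (A a m) x) ` {-1..1}"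
      by (auto simp: f_def cl_def)
    ultimately show ?thesis
      using compact_imp_bounded bounded_subset by blast
  qed
  let ?I = "\<lambda>j. \<Sum>b<q. \<Sum>a<p. integral\<^sup>L (discrete_measure p q T \<nu> \<xi> A B lam (r j) b a) (f b a)"
  have "?I \<longlonglongrightarrow> (\<Sum>b<q. \<Sum>a<p. integral\<^sup>L (\<psi> b a) (f b a))"
    using conv cont bdd by (intro tendsto_sum) (auto simp: converges_weakly_def)
  also have "(\<Sum>b<q. \<Sum>a<p. integral\<^sup>L (\<psi> b a) (f b a)) =
      (\<Sum>b<q. \<Sum>a<p. \<integral>x. poly (B b n) x * poly (A a m) x \<partial>\<psi> b a)"
  proof (intro sum.cong refl)
    fix b a assume "b \<in> {..<q}" "a \<in> {..<p}"
    then interpret unit_interval_measure "\<psi> b a"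
      using unit_interval_measure by simp
    show "integral\<^sup>L (\<psi> b a) (f b a) = (\<integral>x. poly (B b n) x * poly (A a m) x \<partial>\<psi> b a)"
    proof (rule integral_cong_AE)
      show "f b a \<in> borel_measurable (\<psi> b a)"
        by (intro borel_measurable_integrable integrable_continuous cont)
      show "(\<lambda>x. poly (B b n) x * poly (A a m) x) \<in> borel_measurable (\<psi> b a)"
        by (intro borel_measurable_integrable integrable_continuous continuous_intros)
      show "AE x in \<psi> b a. f b a x = poly (B b n) x * poly (A a m) x"
        using AE_unit_interval by eventually_elim (simp add: f_def cl)
    qed
  qed
  finally have lim: "?I \<longlonglongrightarrow> (\<Sum>b<q. \<Sum>a<p. \<integral>x. poly (B b n) x * poly (A a m) x \<partial>\<psi> b a)" .
  have "\<forall>\<^sub>F j in sequentially. ?I j = (if n = m then 1 else 0)"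
  proof -
    have "\<forall>\<^sub>F N in sequentially. (\<forall>k\<le>N.
        (\<forall>b<q. 0 < christoffel_rho q T \<xi> B lam N k b) \<and>
        (\<forall>a<p. 0 < christoffel_mu p T \<nu> A lam N k a)) \<and> max n m \<le> N"
      using positive unfolding christoffel_positive_def
      by (intro eventually_conj eventually_ge_at_top)
    then have "\<forall>\<^sub>F j in sequentially. (\<forall>k\<le>r j.
        (\<forall>b<q. 0 < christoffel_rho q T \<xi> B lam (r j) k b) \<and>
        (\<forall>a<p. 0 < christoffel_mu p T \<nu> A lam (r j) k a)) \<and> max n m \<le> r j"
      using filterlim_subseq[OF r] by (rule eventually_compose_filterlim)
    then show ?thesis
    proof eventually_elim
      case (elim j)
      define N where "N = r j"
      have rho: "0 < christoffel_rho q T \<xi> B lam N k b" if "k \<le> N" "b < q" for k b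
        using elim that by (simp add: N_def)
      have mu: "0 < christoffel_mu p T \<nu> A lam N k a" if "k \<le> N" "a < p" for k a
        using elim that by (simp add: N_def)
      have nm: "n \<le> N" "m \<le> N"
        using elim by (simp_all add: N_def)
      have simple: "poly (charP T N) (lam N k) * poly (pderiv (charP T (Suc N))) (lam N k) \<noteq> 0"
        if "k \<le> N" for k
        using christoffel_mu_eq_0[of N lam k 0] mu[OF that p] p by auto
      have "?I j = (\<Sum>b<q. \<Sum>a<p. \<Sum>k\<le>N. christoffel_rho q T \<xi> B lam N k b *
          christoffel_mu p T \<nu> A lam N k a * f b a (lam N k))"
        unfolding N_def[symmetric] using rho mu
        by (intro sum.cong refl integral_discrete_measure borel_measurable_continuous_onI cont)
          (auto intro!: less_imp_le)
      also have "\<dots> = (\<Sum>b<q. \<Sum>a<p. \<Sum>k\<le>N. (christoffel_rho q T \<xi> B lam N k b * poly (B b n) (lam N k)) *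
          (christoffel_mu p T \<nu> A lam N k a * poly (A a m) (lam N k)))"
        using abs_eigenvalue_le_1[OF lam simple stochastic]
        by (intro sum.cong) (auto simp: f_def cl)
      also have "\<dots> = (\<Sum>k\<le>N. \<Sum>b<q. \<Sum>a<p. (christoffel_rho q T \<xi> B lam N k b * poly (B b n) (lam N k)) *
          (christoffel_mu p T \<nu> A lam N k a * poly (A a m) (lam N k)))"
        by (subst sum.swap[of _ "{..N}" "{..<p}"] , subst sum.swap[of _ "{..N}" "{..<q}"]) simp
      also have "\<dots> = (\<Sum>k\<le>N. u_entry q T B lam N k n * w_entry p T A lam N k m)"
        by (simp add: u_entry_expansion w_entry_expansion sum_product)
      also have "\<dots> = (if n = m then 1 else 0)"
        using biorthonormal_dual[OF lam simple nm] by simp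
      finally show ?case .
    qed
  qed
  then have "?I \<longlonglongrightarrow> (if n = m then 1 else 0)"
    by (rule tendsto_eventually)
  then show ?thesis
    using lim LIMSEQ_unique by blast
qed

text \<open>The recursion for \<open>B\<close> converts a factor \<open>x\<close> into one
  application of \<open>T\<close> on the index \<open>n\<close>; orthogonality is the case
  \<open>k = 0\<close>.\<close>

theorem spectral_representation:
  "(\<Sum>b<q. \<Sum>a<p. \<integral>x. x ^ k * (poly (B b n) x * poly (A a m) x) \<partial>\<psi> b a) = transition_power q T k n m"
proof (induction k arbitrary: n)
  case 0
  then show ?case by (simp add: spectral_orthogonality)
next
  case (Suc k)
  have "(\<integral>x. x ^ Suc k * (poly (B b n) x * poly (A a m) x) \<partial>\<psi> b a) =
      (\<Sum>l\<le>n + q. T n l * (\<integral>x. x ^ k * (poly (B b l) x * poly (A a m) x) \<partial>\<psi> b a))"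
    if "b < q" "a < p" for b a
  proof -
    interpret unit_interval_measure "\<psi> b a"
      using unit_interval_measure that by simp
    have "x ^ Suc k * (poly (B b n) x * poly (A a m) x) =
        (\<Sum>l\<le>n + q. T n l * (x ^ k * (poly (B b l) x * poly (A a m) x)))" for x
    proof -
      have "x ^ Suc k * (poly (B b n) x * poly (A a m) x) =
          (x * poly (B b n) x) * (x ^ k * poly (A a m) x)"
        by simp
      also have "\<dots> = (\<Sum>l\<le>n + q. T n l * poly (B b l) x) * (x ^ k * poly (A a m) x)"
        using right_recursion_polys_eval[OF right \<open>b < q\<close>] by simp
      also have "\<dots> = (\<Sum>l\<le>n + q. T n l * poly (B b l) x * (x ^ k * poly (A a m) x))"
        by (rule sum_distrib_right)
      finally show ?thesis
        by (simp only: mult_ac)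
    qed
    then have "(\<integral>x. x ^ Suc k * (poly (B b n) x * poly (A a m) x) \<partial>\<psi> b a) =
        (\<integral>x. (\<Sum>l\<le>n + q. T n l * (x ^ k * (poly (B b l) x * poly (A a m) x))) \<partial>\<psi> b a)"
      by (simp only:)
    also have "\<dots> = (\<Sum>l\<le>n + q. \<integral>x. T n l * (x ^ k * (poly (B b l) x * poly (A a m) x)) \<partial>\<psi> b a)"
      by (intro Bochner_Integration.integral_sum integrable_continuous continuous_intros)
    finally show ?thesis by simp
  qed
  then have "(\<Sum>b<q. \<Sum>a<p. \<integral>x. x ^ Suc k * (poly (B b n) x * poly (A a m) x) \<partial>\<psi> b a) =
      (\<Sum>b<q. \<Sum>a<p. \<Sum>l\<le>n + q. T n l * (\<integral>x. x ^ k * (poly (B b l) x * poly (A a m) x) \<partial>\<psi> b a))"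
    by (intro sum.cong) auto
  also have "\<dots> = (\<Sum>l\<le>n + q. \<Sum>b<q. \<Sum>a<p. T n l * (\<integral>x. x ^ k * (poly (B b l) x * poly (A a m) x) \<partial>\<psi> b a))"
    by (subst sum.swap[of _ "{..n + q}" "{..<p}"], subst sum.swap[of _ "{..n + q}" "{..<q}"]) simp
  also have "\<dots> = transition_power q T (Suc k) n m"
    by (simp add: Suc flip: sum_distrib_left)
  finally show ?case .
qed

corollary transition_power_tendsto:
  "(\<lambda>k. transition_power q T k n m) \<longlonglongrightarrow>
    (\<Sum>b<q. \<Sum>a<p. measure (\<psi> b a) {1} * (poly (B b n) 1 * poly (A a m) 1))"
  unfolding spectral_representation[symmetric]
  by (intro tendsto_sum unit_interval_measure.moments_tendsto_mass_at_1 unit_interval_measure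
      continuous_intros) auto

end

subsection \<open>Chains with convergent powers\<close>

text \<open>From the spectral side only the existence of the limit \<open>L\<close> is carried over;
  \<open>up\<close> and \<open>down\<close> supply irreducibility.\<close>

locale convergent_chain = banded_stochastic +
  fixes L :: inf_mat
  assumes lim: "\<And>n m. (\<lambda>k. transition_power q T k n m) \<longlonglongrightarrow> L n m"
    and up: "\<And>n. 0 < T n (Suc n)" and down: "\<And>n. 0 < T (Suc n) n"
begin

lemma transition_power_le_1: "P k n m \<le> 1"
proof -
  have "P k n m \<le> (\<Sum>l\<le>m. P k n l)"
    by (rule member_le_sum) (auto intro: transition_power_nonneg)
  then show ?thesis
    using transition_power_partial_row_sum[of k n m] by simp
qed

lemma L_nonneg: "0 \<le> L n m"
  using lim by (rule LIMSEQ_le_const) (auto intro: transition_power_nonneg)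

lemma L_partial_row_sum: "(\<Sum>m\<le>K. L n m) \<le> 1"
proof (rule LIMSEQ_le_const2)
  show "(\<lambda>k. \<Sum>m\<le>K. P k n m) \<longlonglongrightarrow> (\<Sum>m\<le>K. L n m)"
    by (intro tendsto_sum lim)
qed (auto intro: transition_power_partial_row_sum)

lemma L_invariant: "L n m = (\<Sum>l\<le>m + p. L n l * T l m)"
proof (rule LIMSEQ_unique)
  show "(\<lambda>k. P (Suc k) n m) \<longlonglongrightarrow> L n m"
    using lim by (rule LIMSEQ_Suc)
  show "(\<lambda>k. P (Suc k) n m) \<longlonglongrightarrow> (\<Sum>l\<le>m + p. L n l * T l m)"
    unfolding transition_power_Suc_right by (intro tendsto_sum tendsto_mult tendsto_const lim)
qed

lemma L_pos:
  assumes "0 < L n 0"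
  shows "0 < L n m"
proof (induction m)
  case (Suc m)
  have "0 < L n m * T m (Suc m)"
    using Suc up by simp
  also have "\<dots> \<le> (\<Sum>l\<le>Suc m + p. L n l * T l (Suc m))"
    by (rule member_le_sum) (auto intro!: mult_nonneg_nonneg L_nonneg nonneg)
  finally show ?case
    using L_invariant[of n "Suc m"] by simp
qed (fact assms)

text \<open>Indexing by the time \<open>r\<close> elapsed since the last visit makes the avoidance
  factor independent of \<open>t\<close>, ready for \<open>t\<close> to tend to infinity.\<close>

lemma last_visit_reversed:
  "(\<Sum>r<t. P (t - r) n i * avoid i r i) = 1 - avoid i t n"
proof -
  have "(\<Sum>r<t. P (t - r) n i * avoid i r i) =
      (\<Sum>s<t. P (t - (t - Suc s)) n i * avoid i (t - Suc s) i)"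
    by (rule sum.nat_diff_reindex[symmetric])
  also have "\<dots> = (\<Sum>s<t. P (Suc s) n i * avoid i (t - Suc s) i)"
    by (intro sum.cong) auto
  finally show ?thesis
    by (simp only: last_visit)
qed

text \<open>Keep only the first \<open>K\<close> terms of the last-visit decomposition, which are
  nonnegative, and let \<open>t\<close> tend to infinity.\<close>

lemma L_avoid_le_1: "L n i * (\<Sum>r<K. avoid i r i) \<le> 1"
proof (rule LIMSEQ_le_const2)
  have "(\<lambda>t. P (t - r) n i) \<longlonglongrightarrow> L n i" for r
    using filterlim_compose[OF lim filterlim_minus_const_nat_at_top] .
  then show "(\<lambda>t. \<Sum>r<K. P (t - r) n i * avoid i r i) \<longlonglongrightarrow> L n i * (\<Sum>r<K. avoid i r i)"
    unfolding sum_distrib_left by (intro tendsto_sum tendsto_mult tendsto_const)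
  have "(\<Sum>r<K. P (t - r) n i * avoid i r i) \<le> 1" if "K \<le> t" for t
  proof -
    have "(\<Sum>r<K. P (t - r) n i * avoid i r i) \<le> (\<Sum>r<t. P (t - r) n i * avoid i r i)"
      using that by (intro sum_mono2) (auto intro!: mult_nonneg_nonneg transition_power_nonneg avoid_nonneg)
    also have "\<dots> \<le> 1"
      by (simp add: last_visit_reversed avoid_nonneg)
    finally show ?thesis .
  qed
  then show "\<exists>N. \<forall>t\<ge>N. (\<Sum>r<K. P (t - r) n i * avoid i r i) \<le> 1"
    by blast
qed

lemma summable_avoid:
  assumes "0 < L n i"
  shows "summable (\<lambda>t. avoid i t i)"
proof (rule summableI_nonneg_bounded)
  show "(\<Sum>r<K. avoid i r i) \<le> 1 / L n i" for K
    using L_avoid_le_1[of n i K] assms by (simp add: field_simps)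
qed (rule avoid_nonneg)

text \<open>The limit \<open>e\<close> is nonnegative and harmonic and vanishes at \<open>i\<close>,
  since summands of a convergent series tend to zero. Its zeros spread to all states through the
  neighbouring transitions.\<close>

lemma avoid_tendsto_0:
  assumes "summable (\<lambda>t. avoid i t i)"
  shows "(\<lambda>t. avoid i t n) \<longlonglongrightarrow> 0"
proof -
  have "convergent (\<lambda>t. avoid i t n)" for n
    using avoid_decreasing avoid_nonneg
    by (intro Bseq_monoseq_convergent BseqI'[of _ 1] decseq_imp_monoseq decseq_SucI)
      (simp_all add: avoid_le_1 avoid_nonneg del: avoid.simps)
  then obtain e where e: "\<And>n. (\<lambda>t. avoid i t n) \<longlonglongrightarrow> e n"
    unfolding convergent_def by metis
  have e_nonneg: "0 \<le> e n" for n
    using e by (rule LIMSEQ_le_const) (auto intro: avoid_nonneg)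
  have ei: "e i = 0"
    using summable_LIMSEQ_zero[OF assms] e LIMSEQ_unique by blast
  \<comment> \<open>The term \<open>l = i\<close> omitted in \<open>avoid\<close> may be restored in
    the limit because \<open>e i = 0\<close>.\<close>
  have harmonic: "e n = (\<Sum>l\<le>n + q. T n l * e l)" for n
  proof (rule LIMSEQ_unique)
    show "(\<lambda>t. avoid i (Suc t) n) \<longlonglongrightarrow> e n"
      using e by (rule LIMSEQ_Suc)
    have "(\<lambda>t. if l = i then 0 else T n l * avoid i t l) \<longlonglongrightarrow> T n l * e l" for l
      using ei e by (cases "l = i") (auto intro: tendsto_mult_left)
    then show "(\<lambda>t. avoid i (Suc t) n) \<longlonglongrightarrow> (\<Sum>l\<le>n + q. T n l * e l)"
      unfolding avoid.simps by (intro tendsto_sum)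
  qed
  have step: "e l = 0" if "e n = 0" "0 < T n l" for n l
  proof -
    have "l \<le> n + q"
      using upper_band[of n l] that by (intro leI notI) simp
    moreover have "\<forall>j\<in>{..n + q}. T n j * e j = 0"
      using harmonic[of n] that(1) nonneg e_nonneg by (subst (asm) eq_commute) (simp add: sum_nonneg_eq_0_iff)
    ultimately have "T n l * e l = 0" by blast
    then show ?thesis
      using that(2) by simp
  qed
  have down0: "e (i - k) = 0" for k
  proof (induction k)
    case (Suc k)
    show ?case
    proof (cases "k < i")
      case True
      then have "Suc (i - Suc k) = i - k" by simp
      then show ?thesis using step[OF Suc] down[of "i - Suc k"] by simp
    qed (use Suc in simp)
  qed (simp add: ei)
  have up0: "e (i + k) = 0" for k
    by (induction k) (use ei step up in auto)
  have "e n = 0"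
    using down0[of "i - n"] up0[of "n - i"] by (cases "n \<le> i") auto
  then show ?thesis using e by metis
qed

text \<open>The last-visit decomposition passes to the limit by Tannery's theorem with the summable
  bound \<open>avoid i r i\<close>, while its right side tends to \<open>1\<close>. The series is
  the expected return time to \<open>i\<close>.\<close>

lemma L_mult_suminf_avoid:
  assumes "summable (\<lambda>t. avoid i t i)"
  shows "L n i * (\<Sum>t. avoid i t i) = 1"
proof (rule LIMSEQ_unique)
  \<comment> \<open>Padding with zeros turns sums of growing length \<open>t\<close> into series
    over a fixed index set.\<close>
  define a where "a r t = (if r < t then P (t - r) n i * avoid i r i else 0)" for r t
  have "(\<lambda>t. \<Sum>r. a r t) \<longlonglongrightarrow> (\<Sum>r. L n i * avoid i r i)"
  proof (intro tannerys_theorem[THEN conjunct2, THEN conjunct2])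
    show "(\<lambda>t. a r t) \<longlonglongrightarrow> L n i * avoid i r i" for r
    proof -
      have "(\<lambda>t. P (t - r) n i * avoid i r i) \<longlonglongrightarrow> L n i * avoid i r i"
        using filterlim_compose[OF lim filterlim_minus_const_nat_at_top]
        by (intro tendsto_mult tendsto_const)
      moreover have "\<forall>\<^sub>F t in sequentially. a r t = P (t - r) n i * avoid i r i"
        using eventually_gt_at_top[of r] by eventually_elim (simp add: a_def)
      ultimately show ?thesis
        by (simp add: tendsto_cong)
    qed
    have "norm (a r t) \<le> avoid i r i" for r t
      using transition_power_nonneg transition_power_le_1 avoid_nonneg
      by (auto simp: a_def abs_mult intro!: mult_left_le_one_le)
    then show "\<forall>\<^sub>F (r, t) in at_top \<times>\<^sub>F sequentially. norm (a r t) \<le> avoid i r i"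
      by (intro always_eventually) auto
  qed (use assms in auto)
  also have "(\<lambda>t. \<Sum>r. a r t) = (\<lambda>t. 1 - avoid i t n)"
  proof
    fix t
    have "(\<Sum>r. a r t) = (\<Sum>r<t. a r t)"
      by (rule suminf_finite) (auto simp: a_def)
    also have "\<dots> = (\<Sum>r<t. P (t - r) n i * avoid i r i)"
      by (intro sum.cong) (auto simp: a_def)
    finally show "(\<Sum>r. a r t) = 1 - avoid i t n"
      by (simp only: last_visit_reversed)
  qed
  finally show "(\<lambda>t. 1 - avoid i t n) \<longlonglongrightarrow> L n i * (\<Sum>t. avoid i t i)"
    using assms by (simp add: suminf_mult)
  show "(\<lambda>t. 1 - avoid i t n) \<longlonglongrightarrow> 1"
    using tendsto_diff[OF tendsto_const avoid_tendsto_0[OF assms]] by simp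
qed

text \<open>One positive entry suffices: by invariance it makes all of row \<open>0\<close> of
  \<open>L\<close> positive, and \<open>L 0 i\<close> then bounds the series for
  \<open>i\<close>.\<close>

theorem summable_avoid_iff: "(\<forall>i. summable (\<lambda>t. avoid i t i)) \<longleftrightarrow> 0 < L 0 0"
proof
  assume "\<forall>i. summable (\<lambda>t. avoid i t i)"
  then have "L 0 0 * (\<Sum>t. avoid 0 t 0) = 1"
    by (intro L_mult_suminf_avoid) blast
  then show "0 < L 0 0"
    using L_nonneg[of 0 0] by (metis mult_zero_left order_le_less zero_neq_one)
next
  assume "0 < L 0 0"
  then show "\<forall>i. summable (\<lambda>t. avoid i t i)"
    using L_pos summable_avoid by blast
qed

section \<open>Stationary distributions\<close>

lemma stationary_trans:
  assumes "stationary_distribution T \<pi>"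
  shows "(\<lambda>n. \<pi> n * P k n m) sums \<pi> m"
proof (induction k arbitrary: m)
  case 0
  have "(\<lambda>n. \<pi> n * P 0 n m) sums (\<Sum>n\<in>{m}. \<pi> n * P 0 n m)"
    by (rule sums_finite) auto
  then show ?case by simp
next
  case (Suc k)
  have "(\<lambda>n. \<Sum>l\<le>m + p. \<pi> n * P k n l * T l m) sums (\<Sum>l\<le>m + p. \<pi> l * T l m)"
    by (intro sums_sum sums_mult2 Suc)
  moreover have "(\<Sum>l\<le>m + p. \<pi> l * T l m) = \<pi> m"
  proof (rule sums_unique2)
    show "(\<lambda>l. \<pi> l * T l m) sums (\<Sum>l\<le>m + p. \<pi> l * T l m)"
      using lower_band by (intro sums_finite) auto
    show "(\<lambda>l. \<pi> l * T l m) sums \<pi> m"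
      using assms by (simp add: stationary_distribution_def)
  qed
  ultimately show ?case
    unfolding transition_power_Suc_right by (simp add: sum_distrib_left mult_ac)
qed

text \<open>\<open>L n m\<close> is the reciprocal of a series depending on \<open>m\<close> alone,
  so all rows of \<open>L\<close> agree. A stationary \<open>\<pi>\<close> is an average of these
  rows, which gives uniqueness; invariance of the rows gives existence.\<close>

theorem stationary_distribution_iff:
  assumes summable: "\<And>i. summable (\<lambda>t. avoid i t i)"
  shows "stationary_distribution T \<pi> \<longleftrightarrow> (\<forall>n. \<pi> n = L n n)"
proof -
  have L_const: "L n m = L m m" for n m
  proof -
    have "L n m * (\<Sum>t. avoid m t m) = L m m * (\<Sum>t. avoid m t m)"
      using L_mult_suminf_avoid[OF summable] by metis
    moreover have "(\<Sum>t. avoid m t m) \<noteq> 0"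
      using L_mult_suminf_avoid[OF summable, of m m] by auto
    ultimately show ?thesis by simp
  qed
  have unique: "\<pi> n = L n n" if \<pi>: "stationary_distribution T \<pi>" for \<pi> n
  proof -
    have nonneg_\<pi>: "0 \<le> \<pi> l" for l
      using \<pi> by (simp add: stationary_distribution_def)
    have \<pi>1: "\<pi> sums 1"
      using \<pi> by (simp add: stationary_distribution_def)
    have "(\<lambda>k. \<Sum>l. \<pi> l * P k l n) \<longlonglongrightarrow> (\<Sum>l. \<pi> l * L l n)"
    proof (intro tannerys_theorem[THEN conjunct2, THEN conjunct2])
      show "(\<lambda>k. \<pi> l * P k l n) \<longlonglongrightarrow> \<pi> l * L l n" for l
        by (intro tendsto_mult tendsto_const lim)
      have "norm (\<pi> l * P k l n) \<le> \<pi> l" for l k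
        using transition_power_nonneg[of k l n] transition_power_le_1[of k l n] nonneg_\<pi>[of l]
        by (auto simp: abs_mult intro!: mult_left_le)
      then show "\<forall>\<^sub>F (l, k) in at_top \<times>\<^sub>F sequentially. norm (\<pi> l * P k l n) \<le> \<pi> l"
        by (intro always_eventually) auto
    qed (use \<pi>1 sums_summable in auto)
    moreover have "(\<Sum>l. \<pi> l * P k l n) = \<pi> n" for k
      using stationary_trans[OF \<pi>] by (rule sums_unique[symmetric])
    moreover have "(\<Sum>l. \<pi> l * L l n) = L n n"
    proof -
      have "(\<Sum>l. \<pi> l * L l n) = (\<Sum>l. \<pi> l * L n n)"
        by (intro suminf_cong) (metis L_const)
      then show ?thesis
        using sums_mult2[OF \<pi>1, of "L n n"] by (simp add: sums_iff)
    qed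
    ultimately have "(\<lambda>k. \<pi> n) \<longlonglongrightarrow> L n n"
      by (simp only:)
    then show ?thesis
      by (simp only: LIMSEQ_const_iff)
  qed
  have "stationary_distribution T (\<lambda>n. L n n)"
  proof -
    have "summable (\<lambda>n. L n n)"
    proof (rule summableI_nonneg_bounded)
      show "(\<Sum>n<K. L n n) \<le> 1" for K
      proof -
        have "(\<Sum>n<K. L n n) = (\<Sum>n<K. L 0 n)"
          using L_const by metis
        also have "\<dots> \<le> (\<Sum>n\<le>K. L 0 n)"
          by (intro sum_mono2) (auto intro: L_nonneg)
        finally show ?thesis
          using L_partial_row_sum[of 0 K] by simp
      qed
    qed (rule L_nonneg)
    then obtain S where S: "(\<lambda>n. L n n) sums S"
      by (auto simp: summable_def)
    have pos: "0 < L n n" for n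
      using L_mult_suminf_avoid[OF summable, of n n] L_nonneg[of n n]
      by (metis mult_zero_left order_le_less zero_neq_one)
    have "0 < S"
      using suminf_pos[OF sums_summable[OF S] pos] sums_unique[OF S] by simp
    have inv: "(\<lambda>n. L n n * T n m) sums L m m" for m
    proof -
      have "(\<lambda>n. L n n * T n m) sums (\<Sum>n\<le>m + p. L n n * T n m)"
        using lower_band by (intro sums_finite) auto
      also have "(\<Sum>n\<le>m + p. L n n * T n m) = (\<Sum>n\<le>m + p. L m n * T n m)"
        using L_const by metis
      finally show ?thesis
        using L_invariant[of m m] by simp
    qed
    \<comment> \<open>So far only \<open>S > 0\<close> and partial sums at most \<open>1\<close> are
      known. Uniqueness applied to the normalized sequence excludes a loss of mass and forces
      \<open>S = 1\<close>.\<close>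
    have "stationary_distribution T (\<lambda>n. L n n / S)"
      using \<open>0 < S\<close> L_nonneg sums_divide[OF S, where c = S] sums_divide[OF inv, where c = S]
      by (simp add: stationary_distribution_def)
    then have "L 0 0 / S = L 0 0"
      by (rule unique)
    then have "S = 1"
      using pos[of 0] \<open>0 < S\<close> by (simp add: field_simps)
    then show ?thesis
      using S inv L_nonneg by (simp add: stationary_distribution_def)
  qed
  moreover have "\<pi> = (\<lambda>n. L n n)" if "\<forall>n. \<pi> n = L n n"
    using that by auto
  ultimately show ?thesis
    using unique by blast
qed

end

subsection \<open>Return times\<close>

text \<open>A time with values in the positive integers or infinity equals the number of
  \<open>t\<close> lying strictly before it. Integrating this gives the tail-sum formula for the
  expectation.\<close>

lemma return_time_eq_suminf:
  "return_time X i \<omega> = (\<Sum>t. indicator {\<omega>'. \<forall>r. 1 \<le> r \<and> r \<le> t \<longrightarrow> X r \<omega>' \<noteq> i} \<omega>)"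
proof (cases "\<exists>t. 1 \<le> t \<and> X t \<omega> = i")
  case True
  define \<tau> where "\<tau> = (LEAST t. 1 \<le> t \<and> X t \<omega> = i)"
  have \<tau>: "1 \<le> \<tau>" "X \<tau> \<omega> = i"
    using LeastI_ex[OF True] by (simp_all add: \<tau>_def)
  have least: "\<tau> \<le> t" if "1 \<le> t" "X t \<omega> = i" for t
    unfolding \<tau>_def using that by (intro Least_le) simp
  have "return_time X i \<omega> = of_nat \<tau>"
    unfolding return_time_def using \<tau> least
    by (intro antisym INF_lower INF_greatest) auto
  moreover have "(\<Sum>t. indicator {\<omega>'. \<forall>r. 1 \<le> r \<and> r \<le> t \<longrightarrow> X r \<omega>' \<noteq> i} \<omega>) =
      (\<Sum>t<\<tau>. indicator {\<omega>'. \<forall>r. 1 \<le> r \<and> r \<le> t \<longrightarrow> X r \<omega>' \<noteq> i} \<omega> :: ennreal)"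
    using \<tau> by (intro suminf_finite) (auto simp: indicator_def)
  moreover have "\<dots> = (\<Sum>t<\<tau>. 1)"
    using least by (intro sum.cong) (fastforce simp: indicator_def)+
  ultimately show ?thesis by simp
next
  case False
  then have "{t. 1 \<le> t \<and> X t \<omega> = i} = {}" by blast
  then have "return_time X i \<omega> = \<infinity>"
    unfolding return_time_def by simp
  moreover have "(\<Sum>t. indicator {\<omega>'. \<forall>r. 1 \<le> r \<and> r \<le> t \<longrightarrow> X r \<omega>' \<noteq> i} \<omega>) =
      (\<Sum>t::nat. 1 :: ennreal)"
    using False by (intro suminf_cong) (auto simp: indicator_def)
  moreover have "(\<Sum>t::nat. 1 :: ennreal) = \<infinity>"
    by (simp add: suminf_eq_SUP ennreal_SUP_of_nat_eq_top)
  ultimately show ?thesis by (simp only:)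
qed

section \<open>From path probabilities to expected return times\<close>

locale banded_markov_chain = banded_stochastic +
  fixes M :: "nat \<Rightarrow> 's measure" and X :: "nat \<Rightarrow> 's \<Rightarrow> nat"
  assumes chain: "markov_chain T M X"
begin

lemma X_measurable [measurable]: "X t \<in> measurable (M i) (count_space UNIV)"
  using chain by (simp add: markov_chain_def)

lemma prob_space: "prob_space (M i)"
  using chain by (simp add: markov_chain_def)

text \<open>The Markov property speaks of complete initial paths, so the induction is over all paths
  \<open>s\<close>: the event is split by the next state \<open>l\<close>, and the path is extended
  by \<open>l\<close>.\<close>

lemma measure_path_avoid:
  "measure (M i) {\<omega> \<in> space (M i). (\<forall>r\<le>t. X r \<omega> = s r) \<and> (\<forall>r. t < r \<and> r \<le> t + k \<longrightarrow> X r \<omega> \<noteq> j)} =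
    measure (M i) {\<omega> \<in> space (M i). \<forall>r\<le>t. X r \<omega> = s r} * avoid j k (s t)"
proof (induction k arbitrary: t s)
  case 0
  have "{\<omega> \<in> space (M i). (\<forall>r\<le>t. X r \<omega> = s r) \<and> (\<forall>r. t < r \<and> r \<le> t + 0 \<longrightarrow> X r \<omega> \<noteq> j)} =
      {\<omega> \<in> space (M i). \<forall>r\<le>t. X r \<omega> = s r}"
    by auto
  then show ?case by simp
next
  case (Suc k)
  interpret prob_space "M i" by (rule prob_space)
  define s' where "s' l = s(Suc t := l)" for l
  define E where "E l = (if l = j then {} else {\<omega> \<in> space (M i). (\<forall>r\<le>Suc t. X r \<omega> = s' l r) \<and>
    (\<forall>r. Suc t < r \<and> r \<le> Suc t + k \<longrightarrow> X r \<omega> \<noteq> j)})" for l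
  let ?F = "{\<omega> \<in> space (M i). \<forall>r\<le>t. X r \<omega> = s r}"
  have E_path: "X (Suc t) \<omega> = l" if "\<omega> \<in> E l" for \<omega> l
    using that by (auto simp: E_def s'_def split: if_splits)
  have "(\<lambda>l. measure (M i) (E l)) sums measure (M i) (\<Union>l. E l)"
  proof (rule finite_measure_UNION)
    show "disjoint_family E"
      unfolding disjoint_family_on_def using E_path by blast
    have "E l \<in> sets (M i)" for l
      unfolding E_def by simp
    then show "range E \<subseteq> sets (M i)" by blast
  qed
  moreover have "(\<Union>l. E l) = {\<omega> \<in> space (M i). (\<forall>r\<le>t. X r \<omega> = s r) \<and>
      (\<forall>r. t < r \<and> r \<le> t + Suc k \<longrightarrow> X r \<omega> \<noteq> j)}" (is "_ = ?G")
  proof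
    show "(\<Union>l. E l) \<subseteq> ?G"
    proof
      fix \<omega> assume "\<omega> \<in> (\<Union>l. E l)"
      then obtain l where l: "\<omega> \<in> E l" by blast
      then have "l \<noteq> j" "X (Suc t) \<omega> = l"
        using E_path by (auto simp: E_def split: if_splits)
      moreover have "X r \<omega> \<noteq> j" if "Suc t < r" "r \<le> Suc t + k" for r
        using l that by (auto simp: E_def split: if_splits)
      ultimately have "X r \<omega> \<noteq> j" if "t < r" "r \<le> t + Suc k" for r
        using that by (cases "r = Suc t") auto
      then show "\<omega> \<in> ?G"
        using l by (auto simp: E_def s'_def split: if_splits)
    qed
    show "?G \<subseteq> (\<Union>l. E l)"
    proof
      fix \<omega> assume "\<omega> \<in> ?G"
      then have "\<omega> \<in> E (X (Suc t) \<omega>)"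
        by (auto simp: E_def s'_def le_Suc_eq)
      then show "\<omega> \<in> (\<Union>l. E l)" by blast
    qed
  qed
  moreover have "measure (M i) (E l) = measure (M i) ?F * (if l = j then 0 else T (s t) l * avoid j k l)" for l
  proof (cases "l = j")
    case False
    have "measure (M i) (E l) =
        measure (M i) {\<omega> \<in> space (M i). \<forall>r\<le>Suc t. X r \<omega> = s' l r} * avoid j k (s' l (Suc t))"
      unfolding E_def using False by (simp only: if_False) (rule Suc)
    also have "measure (M i) {\<omega> \<in> space (M i). \<forall>r\<le>Suc t. X r \<omega> = s' l r} =
        measure (M i) {\<omega> \<in> space (M i). \<forall>r\<le>t. X r \<omega> = s' l r} * T (s' l t) (s' l (Suc t))"
      using chain unfolding markov_chain_def by blast
    also have "{\<omega> \<in> space (M i). \<forall>r\<le>t. X r \<omega> = s' l r} = ?F"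
      by (auto simp: s'_def)
    finally show ?thesis
      using False by (simp add: s'_def)
  qed (simp add: E_def)
  \<comment> \<open>The band bounds the next state by \<open>s t + q\<close>, so the countable sum
    matches the finite recursion of \<open>avoid\<close>.\<close>
  moreover have "(\<lambda>l. measure (M i) ?F * (if l = j then 0 else T (s t) l * avoid j k l)) sums
      (\<Sum>l\<le>s t + q. measure (M i) ?F * (if l = j then 0 else T (s t) l * avoid j k l))"
    using upper_band by (intro sums_finite) auto
  ultimately have "measure (M i) ?G =
      (\<Sum>l\<le>s t + q. measure (M i) ?F * (if l = j then 0 else T (s t) l * avoid j k l))"
    by (simp add: sums_unique2)
  then show ?case
    unfolding avoid.simps by (simp only: sum_distrib_left)
qed

lemma emeasure_avoid:
  "emeasure (M i) {\<omega> \<in> space (M i). \<forall>r. 1 \<le> r \<and> r \<le> t \<longrightarrow> X r \<omega> \<noteq> i} = ennreal (avoid i t i)"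
proof -
  interpret prob_space "M i" by (rule prob_space)
  have start: "AE \<omega> in M i. X 0 \<omega> = i"
    using chain by (simp add: markov_chain_def)
  have "measure (M i) {\<omega> \<in> space (M i). \<forall>r. 1 \<le> r \<and> r \<le> t \<longrightarrow> X r \<omega> \<noteq> i} =
      measure (M i) {\<omega> \<in> space (M i). (\<forall>r\<le>0. X r \<omega> = i) \<and> (\<forall>r. 0 < r \<and> r \<le> 0 + t \<longrightarrow> X r \<omega> \<noteq> i)}"
  proof (rule finite_measure_eq_AE)
    show "AE \<omega> in M i. (\<omega> \<in> {\<omega> \<in> space (M i). \<forall>r. 1 \<le> r \<and> r \<le> t \<longrightarrow> X r \<omega> \<noteq> i}) =
        (\<omega> \<in> {\<omega> \<in> space (M i). (\<forall>r\<le>0. X r \<omega> = i) \<and> (\<forall>r. 0 < r \<and> r \<le> 0 + t \<longrightarrow> X r \<omega> \<noteq> i)})"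
      using start by eventually_elim auto
  qed measurable
  also have "\<dots> = measure (M i) {\<omega> \<in> space (M i). \<forall>r\<le>0. X r \<omega> = i} * avoid i t i"
    by (rule measure_path_avoid)
  also have "measure (M i) {\<omega> \<in> space (M i). \<forall>r\<le>0. X r \<omega> = i} = 1"
    using start by (subst prob_eq_1) auto
  finally show ?thesis
    by (simp add: emeasure_eq_measure)
qed

text \<open>By the tail-sum formula the expected return time is the series of avoidance
  probabilities; its finiteness also yields almost sure return.\<close>

theorem ergodic_iff: "ergodic M X \<longleftrightarrow> (\<forall>i. summable (\<lambda>t. avoid i t i))"
proof -
  define S where "S i t = {\<omega> \<in> space (M i). \<forall>r. 1 \<le> r \<and> r \<le> t \<longrightarrow> X r \<omega> \<noteq> i}" for i t
  have S [measurable]: "S i t \<in> sets (M i)" for i t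
    unfolding S_def by measurable
  have rt: "return_time X i \<omega> = (\<Sum>t. indicator (S i t) \<omega>)" if "\<omega> \<in> space (M i)" for i \<omega>
    unfolding return_time_eq_suminf using that
    by (intro suminf_cong) (auto simp: indicator_def S_def)
  have meas: "return_time X i \<in> borel_measurable (M i)" for i
    by (subst measurable_cong[OF rt]) measurable
  have "(\<integral>\<^sup>+ \<omega>. return_time X i \<omega> \<partial>M i) = (\<integral>\<^sup>+ \<omega>. (\<Sum>t. indicator (S i t) \<omega>) \<partial>M i)" for i
    by (rule nn_integral_cong) (rule rt)
  also have "\<dots> i = (\<Sum>t. emeasure (M i) (S i t))" for i
    by (subst nn_integral_suminf) auto
  also have "\<dots> i = (\<Sum>t. ennreal (avoid i t i))" for i
    unfolding S_def emeasure_avoid ..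
  finally have expect: "(\<integral>\<^sup>+ \<omega>. return_time X i \<omega> \<partial>M i) = (\<Sum>t. ennreal (avoid i t i))" for i .
  have "(\<integral>\<^sup>+ \<omega>. return_time X i \<omega> \<partial>M i) < \<infinity> \<longleftrightarrow> summable (\<lambda>t. avoid i t i)" for i
  proof
    assume "(\<integral>\<^sup>+ \<omega>. return_time X i \<omega> \<partial>M i) < \<infinity>"
    then show "summable (\<lambda>t. avoid i t i)"
      unfolding expect by (intro summable_suminf_not_top avoid_nonneg) simp
  next
    assume "summable (\<lambda>t. avoid i t i)"
    then show "(\<integral>\<^sup>+ \<omega>. return_time X i \<omega> \<partial>M i) < \<infinity>"
      unfolding expect by (subst suminf_ennreal2) (simp_all add: avoid_nonneg)
  qed
  moreover have "AE \<omega> in M i. return_time X i \<omega> < \<infinity>"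
    if "(\<integral>\<^sup>+ \<omega>. return_time X i \<omega> \<partial>M i) < \<infinity>" for i
    using nn_integral_PInf_AE[OF meas, of i] that by (simp add: less_top[symmetric])
  ultimately show ?thesis
    unfolding ergodic_def by blast
qed

end

section \<open>The criterion in terms of masses at the point 1\<close>

theorem theorem2p22:
  fixes p q :: nat
    and T :: inf_mat
    and \<nu> \<xi> :: "real mat"
    and A B :: "nat \<Rightarrow> nat \<Rightarrow> real poly"
    and lam :: "nat \<Rightarrow> nat \<Rightarrow> real"
    and \<psi> :: "nat \<Rightarrow> nat \<Rightarrow> real measure"
    and M :: "nat \<Rightarrow> 's measure"
    and X :: "nat \<Rightarrow> 's \<Rightarrow> nat"
    and m :: "nat \<Rightarrow> nat \<Rightarrow> real"
  assumes "1 \<le> p" and "1 \<le> q"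
    and "stochastic T" and "positive_banded p q T" and "has_pbf p q T"
    and "lower_unitriangular p \<nu>" and "lower_unitriangular q \<xi>"
    and "left_recursion_polys p T \<nu> A" and "right_recursion_polys q T \<xi> B"
    and "decreasing_eigenvalues T lam"
    and "christoffel_positive p q T \<nu> \<xi> A B lam"
    and "spectral_measures p q T \<nu> \<xi> A B lam \<psi>"
    and "markov_chain T M X"
    and "\<And>b a. m b a = measure (\<psi> b a) {1}"
  shows "(ergodic M X \<longleftrightarrow> m 0 0 > 0 \<and> (\<forall>a<p. \<forall>b<q. m b a \<ge> 0)) \<and>
    (ergodic M X \<longrightarrow>
      (\<forall>\<pi>. stationary_distribution T \<pi> \<longleftrightarrow>
        (\<forall>n. \<pi> n = (\<Sum>a<p. \<Sum>b<q. poly (B b n) 1 * m b a * poly (A a n) 1))))"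
proof -
  have pq: "0 < p" "0 < q"
    using assms(1,2) by simp_all
  have band: "T n l = 0" if "n + q < l \<or> l + p < n" for n l
    using assms(4) that unfolding positive_banded_def by (metis add.commute not_le)
  have pos: "0 < T n l" if "n \<le> l + p" "l \<le> n + q" for n l
    using assms(4) that unfolding positive_banded_def by (metis (full_types))
  interpret S: spectral_chain p q T \<nu> \<xi> A B lam \<psi>
    using assms(3,6-12) pq band by unfold_locales auto
  define L where "L n l = (\<Sum>b<q. \<Sum>a<p. measure (\<psi> b a) {1} * (poly (B b n) 1 * poly (A a l) 1))" for n l
  interpret C: convergent_chain p q T L
  proof
    show "(\<lambda>k. transition_power q T k n l) \<longlonglongrightarrow> L n l" for n l
      unfolding L_def by (rule S.transition_power_tendsto)
  qed (use assms(3) band pos pq in auto)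
  interpret K: banded_markov_chain p q T M X
    by unfold_locales (rule assms(13))
  have erg: "ergodic M X \<longleftrightarrow> (\<forall>i. summable (\<lambda>t. C.avoid i t i))"
    by (rule K.ergodic_iff)
  \<comment> \<open>By unitriangularity of \<open>\<nu>\<close> and \<open>\<xi>\<close>, the
    polynomials with index \<open>n = 0\<close> are \<open>1\<close> for the first superscript and
    \<open>0\<close> for the others.\<close>
  have L00: "L 0 0 = m 0 0"
  proof -
    have B0: "poly (B b 0) 1 = (if b = 0 then 1 else 0)" if "b < q" for b
      using assms(7,9) that pq by (simp add: right_recursion_polys_def lower_unitriangular_def)
    have A0: "poly (A a 0) 1 = (if a = 0 then 1 else 0)" if "a < p" for a
      using assms(6,8) that pq by (simp add: left_recursion_polys_def lower_unitriangular_def)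
    have "L 0 0 = (\<Sum>b<q. \<Sum>a<p. if a = 0 then (if b = 0 then m 0 0 else 0) else 0)"
      unfolding L_def by (intro sum.cong) (auto simp: A0 B0 assms(14))
    then show ?thesis
      using pq by simp
  qed
  have L_diag: "L n n = (\<Sum>a<p. \<Sum>b<q. poly (B b n) 1 * m b a * poly (A a n) 1)" for n
    unfolding L_def assms(14) by (subst sum.swap) (simp add: mult_ac)
  have "0 \<le> m b a" for b a
    by (simp add: assms(14))
  then have "ergodic M X \<longleftrightarrow> m 0 0 > 0 \<and> (\<forall>a<p. \<forall>b<q. m b a \<ge> 0)"
    unfolding erg C.summable_avoid_iff L00 by blast
  moreover have "stationary_distribution T \<pi> \<longleftrightarrow>
      (\<forall>n. \<pi> n = (\<Sum>a<p. \<Sum>b<q. poly (B b n) 1 * m b a * poly (A a n) 1))"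
    if "ergodic M X" for \<pi>
    using C.stationary_distribution_iff[of \<pi>] that unfolding erg L_diag by blast
  ultimately show ?thesis by blast
qed

end
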